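(* Let $G=(V,E)$ be a (connected, locally finite) unimodular transitive graph of degree $d$. Then \[ \mathbf{P}_p(\mathscr{S}_{e,n})\leq 66\cdot d\left[\frac{1-p}{pn}\right]^{1/2} \] for every $e\in E$, $p\in(0,1]$ and $n\geq 1$.
   Context: A graph $G=(V,E)$ is transitive if for any two vertices $u,v\in V$ there is an automorphism of $G$ mapping $u$ to $v$. Let $\operatorname{Aut}(G)$ be the automorphism group of $G$, let $\operatorname{Stab}_v=\{\gamma\in\operatorname{Aut}(G):\gamma v=v\}$ and $\operatorname{Stab}_v u=\{\gamma u:\gamma\in\operatorname{Stab}_v\}$. A transitive graph $G$ is unimodular if $|\operatorname{Stab}_v u|=|\operatorname{Stab}_u v|$ for all $u,v\in V$. Bernoulli-$p$ bond percolation $\omega_p\in\{0,1\}^E$ is the random subgraph of $G$ in which each edge is retained (open, value $1$) independently with probability $p$ and otherwise deleted (closed, value $0$); $\mathbf{P}_p$ denotes its law. Connected components of $\omega_p$ are called clusters. An edge touches a cluster if it has at least one endpoint in it. For an edge $e$ and $n\ge1$, $\mathscr{S}_{e,n}$ is the event that $e$ is closed and that the endpoints of $e$ are in distinct clusters, each of which touches at least $n$ edges of $G$, and at least one of which is finite. *)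

theory Defs
  imports "HOL-Probability.Probability" "HOL-Combinatorics.Permutations"
begin

(* Simple graphs, finite or infinite: vertex set V, and every edge in E is the
   two-element set of its endpoints. *)
locale simple_graph =
  fixes V :: "'v set" and E :: "'v set set"
  assumes edge_subset: "e \<in> E \<Longrightarrow> e \<subseteq> V"
    and edge_card: "e \<in> E \<Longrightarrow> card e = 2"

definition incident_edges :: "'v set set \<Rightarrow> 'v \<Rightarrow> 'v set set" where
  "incident_edges E v = {e \<in> E. v \<in> e}"

definition locally_finite_graph :: "'v set \<Rightarrow> 'v set set \<Rightarrow> bool" where
  "locally_finite_graph V E \<longleftrightarrow> (\<forall>v\<in>V. finite (incident_edges E v))"

definition regular_of_degree :: "'v set \<Rightarrow> 'v set set \<Rightarrow> nat \<Rightarrow> bool" where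
  "regular_of_degree V E d \<longleftrightarrow> (\<forall>v\<in>V. card (incident_edges E v) = d)"

definition graph_component :: "'v set set \<Rightarrow> 'v \<Rightarrow> 'v set" where
  "graph_component F v = {u. (v, u) \<in> {(x, y). {x, y} \<in> F}\<^sup>*}"

definition connected_graph :: "'v set \<Rightarrow> 'v set set \<Rightarrow> bool" where
  "connected_graph V E \<longleftrightarrow> V \<noteq> {} \<and> (\<forall>v\<in>V. graph_component E v = V)"

(* "permutes" makes an automorphism the identity outside V, so that distinct
   elements of this set are distinct as maps on V. *)
definition graph_Aut :: "'v set \<Rightarrow> 'v set set \<Rightarrow> ('v \<Rightarrow> 'v) set" where
  "graph_Aut V E =
     {\<gamma>. \<gamma> permutes V \<and> (\<forall>u\<in>V. \<forall>v\<in>V. {\<gamma> u, \<gamma> v} \<in> E \<longleftrightarrow> {u, v} \<in> E)}"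

definition graph_Stab :: "'v set \<Rightarrow> 'v set set \<Rightarrow> 'v \<Rightarrow> ('v \<Rightarrow> 'v) set" where
  "graph_Stab V E v = {\<gamma> \<in> graph_Aut V E. \<gamma> v = v}"

definition Stab_orbit :: "'v set \<Rightarrow> 'v set set \<Rightarrow> 'v \<Rightarrow> 'v \<Rightarrow> 'v set" where
  "Stab_orbit V E v u = {\<gamma> u | \<gamma>. \<gamma> \<in> graph_Stab V E v}"

definition transitive_graph :: "'v set \<Rightarrow> 'v set set \<Rightarrow> bool" where
  "transitive_graph V E \<longleftrightarrow> (\<forall>u\<in>V. \<forall>v\<in>V. \<exists>\<gamma>\<in>graph_Aut V E. \<gamma> u = v)"

(* In a connected, locally finite graph the stabilizer orbits are finite (they lie
   in spheres), so card is their true cardinality. *)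
definition unimodular_graph :: "'v set \<Rightarrow> 'v set set \<Rightarrow> bool" where
  "unimodular_graph V E \<longleftrightarrow>
     (\<forall>u\<in>V. \<forall>v\<in>V. card (Stab_orbit V E v u) = card (Stab_orbit V E u v))"

(* True means open. *)
definition bernoulli_percolation :: "'v set set \<Rightarrow> real \<Rightarrow> ('v set \<Rightarrow> bool) measure" where
  "bernoulli_percolation E p = PiM E (\<lambda>_. measure_pmf (bernoulli_pmf p))"

definition cluster :: "'v set set \<Rightarrow> ('v set \<Rightarrow> bool) \<Rightarrow> 'v \<Rightarrow> 'v set" where
  "cluster E \<omega> v = graph_component {f \<in> E. \<omega> f} v"

definition touching_edges :: "'v set set \<Rightarrow> 'v set \<Rightarrow> 'v set set" where
  "touching_edges E C = {f \<in> E. f \<inter> C \<noteq> {}}"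

(* card is 0 on infinite sets, hence the separate disjunct. *)
definition touches_at_least :: "'v set set \<Rightarrow> nat \<Rightarrow> 'v set \<Rightarrow> bool" where
  "touches_at_least E n C \<longleftrightarrow>
     infinite (touching_edges E C) \<or> n \<le> card (touching_edges E C)"

definition two_cluster_event ::
    "'v set set \<Rightarrow> real \<Rightarrow> 'v set \<Rightarrow> nat \<Rightarrow> ('v set \<Rightarrow> bool) set" where
  "two_cluster_event E p e n =
     {\<omega> \<in> space (bernoulli_percolation E p).
        \<not> \<omega> e \<and>
        (\<exists>x y. e = {x, y} \<and>
           cluster E \<omega> x \<noteq> cluster E \<omega> y \<and>
           touches_at_least E n (cluster E \<omega> x) \<and>
           touches_at_least E n (cluster E \<omega> y) \<and>
           (finite (cluster E \<omega> x) \<or> finite (cluster E \<omega> y)))}"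

end

theory Submission
  imports Defs
begin

text \<open>
  Give an edge the score \<open>p\<close> if it is closed and \<open>p - 1\<close> if it is open, and give a finite cluster
  touching \<open>m\<close> edges the mass \<open>min m n / n\<close>. Closing an edge never decreases the mass of the clusters
  touching it, and increases it by at least 1 on the two-cluster event. Hence the probability of this
  event is controlled by the expected product of the score of the edge and the mass around it. By the
  mass-transport principle the sum of these expectations over the edges at a vertex equals the
  expectation, for the cluster of this vertex, of mass per vertex times total score of the touching
  edges. Exploring the cluster edge by edge turns its total score into a sum of centred increments, so
  a weighted second moment bound and the inequality of arithmetic and geometric means give the
  decay \<open>1 / sqrt n\<close>. Clusters are truncated by their diameter \<open>r\<close> in the ambient graph, and
  \<open>r\<close> tends to infinity at the end.
\<close>

section \<open>Components and balls\<close>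

text \<open>The mass is built so that opening a closed edge between two distinct clusters never
  gains mass. It is subadditive under union, it is capped at 1, so that two large finite clusters
  lose a unit when they merge, and it vanishes on infinite clusters, so that a large finite cluster
  loses its unit when it joins an infinite one. An infinite cluster has no mass per vertex and no
  total score. Truncation by diameter makes all sums finite and bounds the range of the transport;
  as it passes to subsets, the mass stays subadditive. The rate comes from comparing sizes. A
  cluster touching \<open>m\<close> edges has mass per vertex at most \<open>d / max n m\<close>,
  and its total score should be of order \<open>sqrt m\<close>. Since \<open>m\<close> depends on
  the scores, the square of the total score is weighted by the power -3/2 of \<open>max n m\<close>.
  This weight decreases along the exploration, so revealing the \<open>i\<close>-th edge costs at
  most \<open>p (1 - p)\<close> times the weight at \<open>i\<close>, and the weights sum to at most
  \<open>3 / sqrt n\<close>.\<close>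

definition adjacency :: "'v set set \<Rightarrow> ('v \<times> 'v) set" where
  "adjacency F = {(x, y). {x, y} \<in> F}"

lemma graph_component_iff: "u \<in> graph_component F v \<longleftrightarrow> (v, u) \<in> (adjacency F)\<^sup>*"
  by (simp add: graph_component_def adjacency_def)

lemma sym_adjacency: "sym (adjacency F)"
  by (auto simp: sym_def adjacency_def insert_commute)

lemma graph_component_refl [simp]: "v \<in> graph_component F v"
  by (simp add: graph_component_iff)

lemma graph_component_sym: "u \<in> graph_component F v \<Longrightarrow> v \<in> graph_component F u"
  using symD[OF sym_rtrancl[OF sym_adjacency]] by (simp add: graph_component_iff)

lemma graph_component_eq: "u \<in> graph_component F v \<Longrightarrow> graph_component F u = graph_component F v"
  by (meson graph_component_iff graph_component_sym rtrancl_trans subsetI subset_antisym)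

lemma graph_component_step:
  "x \<in> graph_component F v \<Longrightarrow> {x, y} \<in> F \<Longrightarrow> y \<in> graph_component F v"
  by (auto simp: graph_component_iff adjacency_def intro: rtrancl_into_rtrancl)

lemma graph_component_mono: "F \<subseteq> F' \<Longrightarrow> graph_component F v \<subseteq> graph_component F' v"
proof
  fix u assume F: "F \<subseteq> F'" and u: "u \<in> graph_component F v"
  from F have "adjacency F \<subseteq> adjacency F'" by (auto simp: adjacency_def)
  then have "(adjacency F)\<^sup>* \<subseteq> (adjacency F')\<^sup>*" by (rule rtrancl_mono)
  with u show "u \<in> graph_component F' v" by (auto simp: graph_component_iff)
qed

lemma graph_component_least:
  assumes "v \<in> C" and "\<And>x y. x \<in> C \<Longrightarrow> {x, y} \<in> F \<Longrightarrow> y \<in> C"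
  shows "graph_component F v \<subseteq> C"
proof
  fix u assume "u \<in> graph_component F v"
  then have "(v, u) \<in> (adjacency F)\<^sup>*" by (simp add: graph_component_iff)
  then show "u \<in> C"
    by (induction rule: rtrancl_induct) (use assms in \<open>auto simp: adjacency_def\<close>)
qed

lemma graph_component_insert_edge:
  "graph_component (insert {x, y} F) x = graph_component F x \<union> graph_component F y"
proof
  show "graph_component (insert {x, y} F) x \<subseteq> graph_component F x \<union> graph_component F y"
  proof (rule graph_component_least)
    fix u w assume u: "u \<in> graph_component F x \<union> graph_component F y"
      and "{u, w} \<in> insert {x, y} F"
    then consider "{u, w} = {x, y}" | "{u, w} \<in> F" by blast
    then show "w \<in> graph_component F x \<union> graph_component F y"
    proof cases
      case 1
      then have "w = x \<or> w = y" by (auto simp: doubleton_eq_iff)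
      then show ?thesis by auto
    next
      case 2
      then show ?thesis using u graph_component_step by (metis Un_iff)
    qed
  qed simp
next
  have "graph_component F y \<subseteq> graph_component (insert {x, y} F) y"
    by (rule graph_component_mono) auto
  also have "\<dots> = graph_component (insert {x, y} F) x"
    by (rule graph_component_eq, rule graph_component_step[of x]) auto
  finally show "graph_component F x \<union> graph_component F y \<subseteq> graph_component (insert {x, y} F) x"
    using graph_component_mono[of F "insert {x, y} F" x] by auto
qed

text \<open>Adding the identity turns the \<open>r\<close>-th power of the relation into walks of
  length at most \<open>r\<close>, so that balls increase with \<open>r\<close>.\<close>

definition graph_ball :: "'v set set \<Rightarrow> nat \<Rightarrow> 'v \<Rightarrow> 'v set" where
  "graph_ball E r v = {u. (v, u) \<in> (adjacency E \<union> Id) ^^ r}"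

lemma graph_ball_0 [simp]: "graph_ball E 0 v = {v}"
  by (auto simp: graph_ball_def)

lemma graph_ball_Suc:
  "graph_ball E (Suc r) v = graph_ball E r v \<union> {w. \<exists>u\<in>graph_ball E r v. {u, w} \<in> E}"
  by (auto simp: graph_ball_def adjacency_def)

lemma graph_ball_self [simp]: "v \<in> graph_ball E r v"
  by (induction r) (auto simp: graph_ball_Suc)

lemma graph_ball_mono: "r \<le> s \<Longrightarrow> graph_ball E r v \<subseteq> graph_ball E s v"
  by (rule lift_Suc_mono_le[of "\<lambda>r. graph_ball E r v"]) (auto simp: graph_ball_Suc)

lemma graph_ball_sym: "u \<in> graph_ball E r v \<longleftrightarrow> v \<in> graph_ball E r u"
proof -
  have "(adjacency E \<union> Id)\<inverse> = adjacency E \<union> Id"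
    using sym_adjacency[of E] by (auto simp: sym_conv_converse_eq)
  then have "((adjacency E \<union> Id) ^^ r)\<inverse> = (adjacency E \<union> Id) ^^ r"
  proof (induction r)
    case (Suc r)
    then show ?case
      using \<open>(adjacency E \<union> Id)\<inverse> = adjacency E \<union> Id\<close>
      by (metis converse_relcomp relpow.simps(2) relpow_commute)
  qed simp
  then show ?thesis by (auto simp: graph_ball_def)
qed

lemma graph_component_eq_Union_ball: "graph_component E v = (\<Union>r. graph_ball E r v)"
proof -
  have "(adjacency E)\<^sup>* = (adjacency E \<union> Id)\<^sup>*"
    by (simp add: rtrancl_reflcl)
  then show ?thesis
    by (auto simp: graph_component_iff graph_ball_def rtrancl_is_UN_relpow)
qed

section \<open>Edges, finite balls and countability of the ambient graph\<close>

lemma (in simple_graph) edge_doubleton: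
  assumes "e \<in> E"
  obtains x y where "e = {x, y}" "x \<noteq> y" "x \<in> V" "y \<in> V"
  using edge_subset[OF assms] edge_card[OF assms] by (auto simp: card_2_iff)

lemma (in simple_graph) edge_at:
  assumes "e \<in> E" "x \<in> e"
  obtains y where "e = {x, y}" "x \<noteq> y" "x \<in> V" "y \<in> V"
  using edge_doubleton[OF assms(1)] assms(2) by (metis insert_commute insertE singletonD)

lemma (in simple_graph) finite_edge: "e \<in> E \<Longrightarrow> finite e"
  using edge_card card.infinite by fastforce

locale connected_lf_graph = simple_graph V E for V :: "'v set" and E +
  assumes conn: "connected_graph V E" and lf: "locally_finite_graph V E"
begin

lemma component_subset: "F \<subseteq> E \<Longrightarrow> v \<in> V \<Longrightarrow> graph_component F v \<subseteq> V"
  using graph_component_mono[of F E v] conn by (auto simp: connected_graph_def)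

lemma cluster_subset: "v \<in> V \<Longrightarrow> cluster E w v \<subseteq> V"
  unfolding cluster_def by (rule component_subset) auto

lemma graph_ball_subset: "v \<in> V \<Longrightarrow> graph_ball E r v \<subseteq> V"
  using component_subset[of E v] by (auto simp: graph_component_eq_Union_ball)

lemma ball_exhausts: "u \<in> V \<Longrightarrow> v \<in> V \<Longrightarrow> \<exists>r. u \<in> graph_ball E r v"
  using conn by (auto simp: connected_graph_def graph_component_eq_Union_ball)

lemma touching_edges_eq: "touching_edges E C = (\<Union>v\<in>C. incident_edges E v)"
  by (auto simp: touching_edges_def incident_edges_def)

lemma finite_touching_edges: "C \<subseteq> V \<Longrightarrow> finite C \<Longrightarrow> finite (touching_edges E C)"
  using lf by (auto simp: touching_edges_eq locally_finite_graph_def)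

lemma finite_graph_ball: "v \<in> V \<Longrightarrow> finite (graph_ball E r v)"
proof (induction r)
  case (Suc r)
  have "graph_ball E (Suc r) v
      \<subseteq> graph_ball E r v \<union> \<Union> (touching_edges E (graph_ball E r v))"
    by (auto simp: graph_ball_Suc touching_edges_def)
  moreover have "finite (\<Union> (touching_edges E (graph_ball E r v)))"
    using finite_touching_edges[OF graph_ball_subset] Suc
    by (auto simp: touching_edges_def finite_edge)
  ultimately show ?case using Suc by (meson finite_UnI finite_subset)
qed simp

lemma countable_V: "countable V"
proof -
  obtain v where v: "v \<in> V" using conn by (auto simp: connected_graph_def)
  then have "V = (\<Union>r. graph_ball E r v)"
    using conn by (auto simp: connected_graph_def graph_component_eq_Union_ball)
  moreover have "countable (\<Union>r. graph_ball E r v)"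
    using finite_graph_ball[OF v] by (auto intro: countable_finite)
  ultimately show ?thesis by simp
qed

end

section \<open>Resampling one edge\<close>

locale edge_percolation = connected_lf_graph V E for V :: "'v set" and E +
  fixes p :: real
  assumes p01: "0 \<le> p" "p \<le> 1"
begin

abbreviation "BP \<equiv> bernoulli_percolation E p"

sublocale BP: prob_space BP
  unfolding bernoulli_percolation_def
  by (intro prob_space_PiM) (auto simp: measure_pmf.prob_space_axioms)

lemma space_BP: "space BP = PiE E (\<lambda>_. UNIV)"
  by (simp add: bernoulli_percolation_def space_PiM)

lemma measurable_edge [measurable]: "f \<in> E \<Longrightarrow> (\<lambda>w. w f) \<in> measurable BP (count_space UNIV)"
  unfolding bernoulli_percolation_def
  using measurable_component_singleton[of f E "\<lambda>_. measure_pmf (bernoulli_pmf p)"]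
  by (simp cong: measurable_cong_sets)

lemma measurable_into_BP:
  assumes "\<And>w. w \<in> space M \<Longrightarrow> g w \<in> PiE E (\<lambda>_. UNIV)"
    and "\<And>f. f \<in> E \<Longrightarrow> (\<lambda>w. g w f) \<in> measurable M (count_space UNIV)"
  shows "g \<in> measurable M BP"
  unfolding bernoulli_percolation_def
  by (rule measurable_PiM_single') (use assms in \<open>auto cong: measurable_cong_sets simp: Pi_iff\<close>)

lemma update_in_space: "f \<in> E \<Longrightarrow> w \<in> space BP \<Longrightarrow> w(f := b) \<in> space BP"
  by (auto simp: space_BP PiE_iff extensional_def)

lemma measurable_update [measurable]: "f \<in> E \<Longrightarrow> (\<lambda>w. w(f := b)) \<in> measurable BP BP"
  by (rule measurable_into_BP) (auto simp: space_BP fun_upd_def PiE_iff extensional_def)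

text \<open>Overwriting the state of \<open>f\<close> by an independent coin preserves the product
  law, since adjoining the coordinate \<open>f\<close> to \<open>E\<close> gives \<open>E\<close>
  again. Fubini then integrates out the coin; the bound \<open>K\<close> supplies
  integrability.\<close>

lemma expectation_resample:
  fixes G :: "('v set \<Rightarrow> bool) \<Rightarrow> real"
  assumes f: "f \<in> E" and G [measurable]: "G \<in> borel_measurable BP"
    and bound: "\<And>w. w \<in> space BP \<Longrightarrow> \<bar>G w\<bar> \<le> K"
  shows "(\<integral>w. G w \<partial>BP) = p * (\<integral>w. G (w(f := True)) \<partial>BP) + (1 - p) * (\<integral>w. G (w(f := False)) \<partial>BP)"
proof -
  let ?B = "measure_pmf (bernoulli_pmf p)"
  interpret P: pair_prob_space ?B BP ..
  have eq: "distr (?B \<Otimes>\<^sub>M BP) BP (\<lambda>(b, w). w(f := b)) = BP"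
    using distr_pair_PiM_eq_PiM[of E "\<lambda>_. ?B" f] f
    by (simp add: bernoulli_percolation_def insert_absorb measure_pmf.prob_space_axioms)
  have upd: "(\<lambda>(b, w). w(f := b)) \<in> measurable (?B \<Otimes>\<^sub>M BP) BP"
  proof (rule measurable_into_BP)
    fix g assume g: "g \<in> E"
    then have [measurable]: "(\<lambda>w. w g) \<in> measurable BP (count_space UNIV)" by simp
    have "(\<lambda>x. if g = f then fst x else snd x g) \<in> measurable (?B \<Otimes>\<^sub>M BP) (count_space UNIV)"
      by measurable
    then show "(\<lambda>x. (case x of (b, w) \<Rightarrow> w(f := b)) g) \<in> measurable (?B \<Otimes>\<^sub>M BP) (count_space UNIV)"
      by (simp add: case_prod_beta' fun_upd_def)
  qed (use update_in_space[OF f] in \<open>auto simp: space_pair_measure space_BP\<close>)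
  have meas: "(\<lambda>(b, w). G (w(f := b))) \<in> borel_measurable (?B \<Otimes>\<^sub>M BP)"
    using measurable_compose[OF upd G] by (simp add: case_prod_beta')
  have int: "integrable (?B \<Otimes>\<^sub>M BP) (\<lambda>(b, w). G (w(f := b)))"
    by (rule P.P.integrable_const_bound[of _ K])
       (use meas bound update_in_space[OF f] in \<open>auto simp: space_pair_measure\<close>)
  have "(\<integral>w. G w \<partial>BP) = (\<integral>x. G (case x of (b, w) \<Rightarrow> w(f := b)) \<partial>(?B \<Otimes>\<^sub>M BP))"
    by (subst eq[symmetric], rule integral_distr[OF upd G])
  also have "\<dots> = (\<integral>b. (\<integral>w. G (w(f := b)) \<partial>BP) \<partial>?B)"
    using P.integral_fst'[OF int] by (simp add: case_prod_beta')
  also have "\<dots> = p * (\<integral>w. G (w(f := True)) \<partial>BP) + (1 - p) * (\<integral>w. G (w(f := False)) \<partial>BP)"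
    using p01 by (subst integral_bernoulli_pmf) (auto simp: mult.commute)
  finally show ?thesis .
qed

end

section \<open>Measurability of clusters and of functions of a cluster\<close>

context edge_percolation
begin

text \<open>Being in the cluster means being reached by an open path of length at most
  \<open>r\<close> for some \<open>r\<close>; for each \<open>r\<close> this is a countable
  combination of edge states, as all intermediate vertices lie in the countable set
  \<open>V\<close>.\<close>

lemma pred_cluster_mem [measurable]:
  assumes v: "v \<in> V"
  shows "Measurable.pred BP (\<lambda>w. u \<in> cluster E w v)"
proof -
  have [measurable]: "Measurable.pred BP (\<lambda>w. u \<in> graph_ball {f \<in> E. w f} r v)" for r u
  proof (induction r arbitrary: u)
    case 0
    then show ?case by (simp add: pred_def)
  next
    case (Suc r)
    note Suc [measurable]
    have sub: "graph_ball {f \<in> E. w f} r v \<subseteq> V" for w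
      using component_subset[of "{f \<in> E. w f}" v] v by (auto simp: graph_component_eq_Union_ball)
    have "(\<lambda>w. u \<in> graph_ball {f \<in> E. w f} (Suc r) v) =
       (\<lambda>w. u \<in> graph_ball {f \<in> E. w f} r v \<or>
            (\<exists>x\<in>V. {x, u} \<in> E \<and> (x \<in> graph_ball {f \<in> E. w f} r v \<and> w {x, u})))"
      using sub by (auto simp: graph_ball_Suc fun_eq_iff)
    moreover have "Measurable.pred BP
        (\<lambda>w. {x, u} \<in> E \<and> (x \<in> graph_ball {f \<in> E. w f} r v \<and> w {x, u}))" for x
      by (cases "{x, u} \<in> E") (simp_all, measurable)
    then have "Measurable.pred BP (\<lambda>w. \<exists>x\<in>V. {x, u} \<in> E \<and>
        (x \<in> graph_ball {f \<in> E. w f} r v \<and> w {x, u}))"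
      by (intro measurable_pred_countable(2) countable_V)
    ultimately show ?case by simp
  qed
  have "Measurable.pred BP (\<lambda>w. \<exists>r. u \<in> graph_ball {f \<in> E. w f} r v)"
    by measurable
  then show ?thesis
    by (simp add: cluster_def graph_component_eq_Union_ball)
qed

text \<open>A cluster is never empty, so the empty set can stand for the infinite clusters.\<close>

definition finite_cluster :: "('v set \<Rightarrow> bool) \<Rightarrow> 'v \<Rightarrow> 'v set" where
  "finite_cluster w v = (if finite (cluster E w v) then cluster E w v else {})"

lemma cluster_self [simp]: "v \<in> cluster E w v"
  by (simp add: cluster_def)

text \<open>A countable set has countably many finite subsets, so preimages of points suffice.
  Nonempty values are decided by countably many membership events, and the empty value is what the
  others leave over.\<close>

lemma measurable_finite_cluster:
  assumes v: "v \<in> V"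
  shows "(\<lambda>w. finite_cluster w v) \<in> measurable BP (count_space {C. finite C \<and> C \<subseteq> V})"
proof -
  let ?F = "{C. finite C \<and> C \<subseteq> V}"
  have cF: "countable ?F" using countable_Collect_finite_subset[OF countable_V] by simp
  have ne: "(\<lambda>w. finite_cluster w v) -` {C} \<inter> space BP \<in> sets BP" if "C \<in> ?F" "C \<noteq> {}" for C
  proof -
    have "(\<lambda>w. finite_cluster w v) -` {C} \<inter> space BP =
        {w \<in> space BP. \<forall>u\<in>V. u \<in> cluster E w v \<longleftrightarrow> u \<in> C}"
    proof -
      have "finite_cluster w v = C \<longleftrightarrow> cluster E w v = C" for w
        using that by (auto simp: finite_cluster_def)
      moreover have "cluster E w v = C \<longleftrightarrow> (\<forall>u\<in>V. u \<in> cluster E w v \<longleftrightarrow> u \<in> C)" for w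
        using that cluster_subset[OF v, of w] by blast
      ultimately show ?thesis by auto
    qed
    moreover have "Measurable.pred BP (\<lambda>w. \<forall>u\<in>V. u \<in> cluster E w v \<longleftrightarrow> u \<in> C)"
      using v by (intro measurable_pred_countable(1) countable_V) measurable
    ultimately show ?thesis by (simp add: pred_def)
  qed
  have "(\<lambda>w. finite_cluster w v) -` {{}} \<inter> space BP =
      space BP - (\<Union>C\<in>?F - {{}}. (\<lambda>w. finite_cluster w v) -` {C} \<inter> space BP)"
    using cluster_subset[OF v] by (auto simp: finite_cluster_def)
  also have "\<dots> \<in> sets BP"
    using ne cF by (intro sets.Diff sets.top sets.countable_UN'') auto
  finally have "(\<lambda>w. finite_cluster w v) -` {C} \<inter> space BP \<in> sets BP" if "C \<in> ?F" for C
    using ne that by (cases "C = {}") auto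
  moreover have "finite_cluster w v \<in> ?F" for w
    using cluster_subset[OF v] by (auto simp: finite_cluster_def)
  ultimately show ?thesis
    by (subst measurable_count_space_eq_countable[OF cF]) auto
qed

text \<open>With countably many values of \<open>finite_cluster\<close>, measurability of
  \<open>H C\<close> for each fixed finite \<open>C\<close> is enough, even though \<open>H\<close>
  also reads the configuration.\<close>

lemma borel_measurable_cluster:
  fixes H :: "'v set \<Rightarrow> ('v set \<Rightarrow> bool) \<Rightarrow> real"
  assumes v: "v \<in> V"
    and H: "\<And>C. finite C \<Longrightarrow> C \<subseteq> V \<Longrightarrow> H C \<in> borel_measurable BP"
    and inf: "\<And>C w. infinite C \<Longrightarrow> H C w = 0"
  shows "(\<lambda>w. H (cluster E w v) w) \<in> borel_measurable BP"
proof -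
  have "(\<lambda>w. (\<lambda>C w. if C = {} then 0 else H C w) (finite_cluster w v) w) \<in> borel_measurable BP"
    by (rule measurable_compose_countable'[OF _ measurable_finite_cluster[OF v]])
       (use H countable_Collect_finite_subset[OF countable_V] in auto)
  moreover have "(if finite_cluster w v = {} then 0 else H (finite_cluster w v) w) = H (cluster E w v) w" for w
    using inf cluster_self[of v w] by (auto simp: finite_cluster_def simp del: cluster_self)
  ultimately show ?thesis by simp
qed

section \<open>Second moment of the fluctuation of a cluster\<close>

text \<open>Centred, since \<open>p (p - 1) + (1 - p) p = 0\<close>, with variance
  \<open>p (1 - p)\<close>. Closed edges get the positive sign because closing an edge raises the
  mass.\<close>

definition edge_score :: "('v set \<Rightarrow> bool) \<Rightarrow> 'v set \<Rightarrow> real" where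
  "edge_score w f = (if w f then p - 1 else p)"

text \<open>Distances are taken in the ambient graph, not inside the cluster. This makes the
  condition hereditary and invariant under automorphisms, and confines the set to a finite ball
  around any of its points.\<close>

definition small_set :: "nat \<Rightarrow> 'v set \<Rightarrow> bool" where
  "small_set r C \<longleftrightarrow> C \<subseteq> V \<and> (\<forall>x\<in>C. C \<subseteq> graph_ball E r x)"

definition fluctuation :: "'v set \<Rightarrow> ('v set \<Rightarrow> bool) \<Rightarrow> real" where
  "fluctuation C w = (\<Sum>f\<in>touching_edges E C. edge_score w f)"

text \<open>Replaces conditioning on a partial exploration: the states on \<open>A\<close> are
  prescribed and the others stay random, so plain integrals over \<open>BP\<close> take the place of
  conditional expectations.\<close>

definition override :: "'v set set \<Rightarrow> 'v set set \<Rightarrow> ('v set \<Rightarrow> bool) \<Rightarrow> 'v set \<Rightarrow> bool" where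
  "override A B w = (\<lambda>f. if f \<in> A then f \<in> B else w f)"

lemma abs_edge_score_le: "\<bar>edge_score w f\<bar> \<le> 1"
  using p01 by (auto simp: edge_score_def)

lemma measurable_edge_score [measurable]:
  "f \<in> E \<Longrightarrow> (\<lambda>w. edge_score w f) \<in> borel_measurable BP"
  unfolding edge_score_def by measurable

lemma touching_edges_subset: "touching_edges E C \<subseteq> E"
  by (auto simp: touching_edges_def)

lemma measurable_fluctuation [measurable]: "fluctuation C \<in> borel_measurable BP"
proof -
  have "(\<lambda>w. \<Sum>f\<in>touching_edges E C. edge_score w f) \<in> borel_measurable BP"
    using touching_edges_subset[of C] by (intro borel_measurable_sum measurable_edge_score) auto
  then show ?thesis by (simp add: fluctuation_def[abs_def])
qed

lemma abs_fluctuation_le: "\<bar>fluctuation C w\<bar> \<le> card (touching_edges E C)"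
proof -
  have "\<bar>fluctuation C w\<bar> \<le> (\<Sum>f\<in>touching_edges E C. \<bar>edge_score w f\<bar>)"
    unfolding fluctuation_def by (rule sum_abs)
  also have "\<dots> \<le> (\<Sum>f\<in>touching_edges E C. 1)"
    by (intro sum_mono abs_edge_score_le)
  finally show ?thesis by simp
qed

lemma small_set_finite: "small_set r C \<Longrightarrow> finite C"
  by (cases "C = {}") (auto simp: small_set_def dest: finite_subset[OF _ finite_graph_ball])

lemma small_set_touching:
  assumes "small_set r C" "v \<in> C"
  shows "touching_edges E C \<subseteq> touching_edges E (graph_ball E r v)"
    and "card (touching_edges E C) \<le> card (touching_edges E (graph_ball E r v))"
    and "finite (touching_edges E C)"
proof -
  have v: "v \<in> V" using assms by (auto simp: small_set_def)
  show sub: "touching_edges E C \<subseteq> touching_edges E (graph_ball E r v)"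
    using assms by (auto simp: small_set_def touching_edges_def)
  have fin: "finite (touching_edges E (graph_ball E r v))"
    using v by (intro finite_touching_edges graph_ball_subset finite_graph_ball)
  show "card (touching_edges E C) \<le> card (touching_edges E (graph_ball E r v))"
    using card_mono[OF fin sub] .
  show "finite (touching_edges E C)" using finite_subset[OF sub fin] .
qed

section \<open>Exploration of a cluster with prescribed edge states\<close>

lemma measurable_override:
  "A \<subseteq> E \<Longrightarrow> override A B \<in> measurable BP BP"
proof (rule measurable_into_BP)
  fix f assume f: "A \<subseteq> E" "f \<in> E"
  then show "(\<lambda>w. override A B w f) \<in> measurable BP (count_space UNIV)"
    by (cases "f \<in> A") (auto simp: override_def)
qed (auto simp: override_def space_BP PiE_iff extensional_def)

lemma override_update:
  "f \<notin> A \<Longrightarrow> override A B (w(f := True)) = override (insert f A) (insert f B) w"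
  "f \<notin> A \<Longrightarrow> B \<subseteq> A \<Longrightarrow> override A B (w(f := False)) = override (insert f A) B w"
  by (auto simp: override_def fun_eq_iff)

lemma cluster_override_superset:
  "B \<subseteq> A \<Longrightarrow> A \<subseteq> E \<Longrightarrow> graph_component B v \<subseteq> cluster E (override A B w) v"
  unfolding cluster_def by (rule graph_component_mono) (auto simp: override_def)

text \<open>An open edge at a vertex of the component touches it, hence lies in \<open>A\<close>,
  hence in \<open>B\<close>, so it cannot lead out of the component.\<close>

lemma cluster_override_explored:
  assumes "B \<subseteq> A" "A \<subseteq> E" "touching_edges E (graph_component B v) \<subseteq> A"
  shows "cluster E (override A B w) v = graph_component B v"
proof
  show "cluster E (override A B w) v \<subseteq> graph_component B v"
    unfolding cluster_def
  proof (rule graph_component_least)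
    fix x y assume x: "x \<in> graph_component B v" and xy: "{x, y} \<in> {f \<in> E. override A B w f}"
    then have "{x, y} \<in> touching_edges E (graph_component B v)"
      by (auto simp: touching_edges_def)
    with assms xy have "{x, y} \<in> B" by (auto simp: override_def)
    with x show "y \<in> graph_component B v" by (rule graph_component_step)
  qed simp
qed (rule cluster_override_superset[OF assms(1,2)])

definition energy :: "(nat \<Rightarrow> real) \<Rightarrow> nat \<Rightarrow> 'v set \<Rightarrow> ('v set \<Rightarrow> bool) \<Rightarrow> real" where
  "energy g r C w = (if small_set r C then g (card (touching_edges E C)) * (fluctuation C w)\<^sup>2 else 0)"

lemma measurable_energy: "v \<in> V \<Longrightarrow> (\<lambda>w. energy g r (cluster E w v) w) \<in> borel_measurable BP"
  unfolding energy_def[abs_def]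
  by (rule borel_measurable_cluster) (auto dest: small_set_finite)

lemma abs_energy_le:
  fixes g :: "nat \<Rightarrow> real"
  assumes g0: "\<And>k. 0 \<le> g k" and gm: "\<And>j k. j \<le> k \<Longrightarrow> g k \<le> g j"
    and M: "card (touching_edges E (graph_ball E r v)) \<le> M"
  shows "\<bar>energy g r (cluster E w v) w\<bar> \<le> g 0 * (real M)\<^sup>2"
proof (cases "small_set r (cluster E w v)")
  case True
  let ?C = "cluster E w v"
  have "real (card (touching_edges E ?C)) \<le> real M"
    using small_set_touching(2)[OF True cluster_self] M by simp
  then have "\<bar>fluctuation ?C w\<bar> \<le> \<bar>real M\<bar>" using abs_fluctuation_le[of ?C w] by linarith
  then have "(fluctuation ?C w)\<^sup>2 \<le> (real M)\<^sup>2" by (simp only: abs_le_square_iff)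
  then show ?thesis using True g0 gm[of 0 "card (touching_edges E ?C)"]
    by (auto simp: energy_def abs_mult intro!: mult_mono)
next
  case False
  then show ?thesis using g0[of 0] by (simp add: energy_def)
qed

text \<open>The edges of \<open>A\<close> have been explored, those of \<open>B\<close> were found open. Revealing one more
  edge at the boundary of the explored cluster adds a centred score of variance \<open>p (1 - p)\<close>.\<close>

lemma exploration_energy_bound:
  fixes g :: "nat \<Rightarrow> real"
  assumes v: "v \<in> V" and g0: "\<And>k. 0 \<le> g k" and gm: "\<And>j k. j \<le> k \<Longrightarrow> g k \<le> g j"
    and M: "card (touching_edges E (graph_ball E r v)) \<le> M"
    and AB: "finite A" "B \<subseteq> A" "A \<subseteq> touching_edges E (graph_component B v)"
  shows "(\<integral>w. energy g r (cluster E (override A B w) v) (override A B w) \<partial>BP)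
    \<le> g (card A) * (\<Sum>f\<in>A. if f \<in> B then p - 1 else p)\<^sup>2 + p * (1 - p) * (\<Sum>i\<in>{card A<..M}. g i)"
  using AB
\<comment> \<open>\<open>M\<close> caps the number of edges touching a small cluster of
  \<open>v\<close> and serves as the exploration budget.\<close>
proof (induction "M - card A" arbitrary: A B rule: less_induct)
  case (less A B)
  define G where "G w = energy g r (cluster E w v) w" for w
  let ?Z = "\<Sum>f\<in>A. if f \<in> B then p - 1 else p"
  have AE: "A \<subseteq> E" using less.prems touching_edges_subset by blast
  have pp: "0 \<le> p * (1 - p)" using p01 by simp
  have rest: "0 \<le> p * (1 - p) * (\<Sum>i\<in>{card A<..M}. g i)"
    by (intro mult_nonneg_nonneg pp sum_nonneg g0)
  have Gmeas: "G \<in> borel_measurable BP"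
    unfolding G_def[abs_def] by (rule measurable_energy[OF v])
  have Gbound: "\<bar>G w\<bar> \<le> g 0 * (real M)\<^sup>2" for w
    unfolding G_def by (rule abs_energy_le[OF g0 gm M])
  show ?case
  proof (cases "touching_edges E (graph_component B v) \<subseteq> A")
    case True
    then have eq: "touching_edges E (graph_component B v) = A" using less.prems by auto
    \<comment> \<open>Nothing random is left: \<open>?Z\<close> is the fluctuation of the cluster,
      and the energy is 0 if the cluster is not small.\<close>
    have "G (override A B w) \<le> g (card A) * ?Z\<^sup>2" for w
    proof -
      have "fluctuation (graph_component B v) (override A B w) = ?Z"
        unfolding fluctuation_def eq by (intro sum.cong) (auto simp: override_def edge_score_def)
      then show ?thesis
        using cluster_override_explored[OF less.prems(2) AE True, of w] g0
        by (auto simp: G_def energy_def eq)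
    qed
    then have "(\<integral>w. G (override A B w) \<partial>BP) \<le> (\<integral>w. g (card A) * ?Z\<^sup>2 \<partial>BP)"
      using measurable_compose[OF measurable_override[OF AE] Gmeas] Gbound
      by (intro integral_mono BP.integrable_const) (auto intro: BP.integrable_const_bound[of _ "g 0 * (real M)\<^sup>2"])
    then show ?thesis using rest by (simp add: G_def BP.prob_space)
  next
    case False
    then obtain f where f: "f \<in> touching_edges E (graph_component B v)" "f \<notin> A" by auto
    then have fE: "f \<in> E" by (auto simp: touching_edges_def)
    have fB: "f \<notin> B" using f less.prems by auto
    have card_ins: "card (insert f A) = Suc (card A)" using f less.prems by simp
    show ?thesis
    proof (cases "card A < M")
      case False
      \<comment> \<open>The budget is spent and \<open>f\<close> is one more edge touching the
        cluster, so the cluster cannot be small.\<close>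
      have "G (override A B w) = 0" for w
      proof (rule ccontr)
        assume "G (override A B w) \<noteq> 0"
        then have sm: "small_set r (cluster E (override A B w) v)"
          by (auto simp: G_def energy_def split: if_splits)
        have "insert f A \<subseteq> touching_edges E (cluster E (override A B w) v)"
          using f less.prems cluster_override_superset[OF less.prems(2) AE, of v w]
          by (auto simp: touching_edges_def)
        then have "card (insert f A) \<le> M"
          using card_mono[OF small_set_touching(3)[OF sm cluster_self]]
            small_set_touching(2)[OF sm cluster_self] M by (meson le_trans)
        then show False using card_ins False by simp
      qed
      then show ?thesis using rest g0 by (simp add: G_def[symmetric])
    next
      case True
      let ?R = "p * (1 - p) * (\<Sum>i\<in>{Suc (card A)<..M}. g i)"
      let ?g = "g (Suc (card A))"
      have m: "M - card (insert f A) < M - card A" using True card_ins by simp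
      have comp: "graph_component B v \<subseteq> graph_component (insert f B) v"
        by (rule graph_component_mono) auto
      have 1: "(\<integral>w. G (override (insert f A) (insert f B) w) \<partial>BP) \<le> ?g * (p - 1 + ?Z)\<^sup>2 + ?R"
      proof -
        have "(\<Sum>h\<in>insert f A. if h \<in> insert f B then p - 1 else p) = p - 1 + ?Z"
          using f less.prems by (subst sum.insert) (auto intro!: sum.cong)
        moreover have "insert f A \<subseteq> touching_edges E (graph_component (insert f B) v)"
          using f less.prems comp by (auto simp: touching_edges_def)
        ultimately show ?thesis
          using less.hyps[OF m, of "insert f B"] less.prems card_ins by (auto simp: G_def)
      qed
      have 2: "(\<integral>w. G (override (insert f A) B w) \<partial>BP) \<le> ?g * (p + ?Z)\<^sup>2 + ?R"
      proof -
        have "(\<Sum>h\<in>insert f A. if h \<in> B then p - 1 else p) = p + ?Z"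
          using f less.prems fB by (subst sum.insert) auto
        then show ?thesis
          using less.hyps[OF m, of B] less.prems card_ins f by (auto simp: G_def)
      qed
      have "(\<integral>w. G (override A B w) \<partial>BP)
          = p * (\<integral>w. G (override (insert f A) (insert f B) w) \<partial>BP)
            + (1 - p) * (\<integral>w. G (override (insert f A) B w) \<partial>BP)"
        using expectation_resample[OF fE measurable_compose[OF measurable_override[OF AE] Gmeas] Gbound]
        by (simp add: override_update[OF f(2)] less.prems)
      also have "\<dots> \<le> p * (?g * (p - 1 + ?Z)\<^sup>2 + ?R) + (1 - p) * (?g * (p + ?Z)\<^sup>2 + ?R)"
        using p01 by (intro add_mono mult_left_mono 1 2) auto
      \<comment> \<open>The terms linear in \<open>?Z\<close> cancel because the score is centred;
        only its variance survives.\<close>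
      also have "\<dots> = ?g * ?Z\<^sup>2 + p * (1 - p) * ?g + ?R"
        by (simp add: power2_eq_square algebra_simps)
      also have "\<dots> = ?g * ?Z\<^sup>2 + p * (1 - p) * (\<Sum>i\<in>{card A<..M}. g i)"
      proof -
        have "{card A<..M} = insert (Suc (card A)) {Suc (card A)<..M}" using True by auto
        then show ?thesis by (simp add: algebra_simps)
      qed
      \<comment> \<open>Antitonicity of \<open>g\<close> restores the weight at the old size: the
        weighted square gains nothing from the growth of the explored set.\<close>
      also have "\<dots> \<le> g (card A) * ?Z\<^sup>2 + p * (1 - p) * (\<Sum>i\<in>{card A<..M}. g i)"
        using gm[of "card A" "Suc (card A)"] by (intro add_right_mono mult_right_mono) auto
      finally show ?thesis by (simp add: G_def)
    qed
  qed
qed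

text \<open>The exploration starts from the empty set, where the score sum is 0 and only the
  accumulated variance remains. As \<open>K\<close> bounds the sums for all \<open>M\<close>, the
  result is uniform in \<open>r\<close>.\<close>

lemma cluster_energy_bound:
  fixes g :: "nat \<Rightarrow> real"
  assumes v: "v \<in> V" and g0: "\<And>k. 0 \<le> g k" and gm: "\<And>j k. j \<le> k \<Longrightarrow> g k \<le> g j"
    and sum: "\<And>M. (\<Sum>i\<in>{0<..M}. g i) \<le> K"
  shows "(\<integral>w. energy g r (cluster E w v) w \<partial>BP) \<le> p * (1 - p) * K"
proof -
  let ?M = "card (touching_edges E (graph_ball E r v))"
  have "override {} {} w = w" for w by (simp add: override_def)
  then have "(\<integral>w. energy g r (cluster E w v) w \<partial>BP) \<le> p * (1 - p) * (\<Sum>i\<in>{0<..?M}. g i)"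
    using exploration_energy_bound[where g=g and r=r and A="{}" and B="{}", OF v g0 gm order.refl]
    by simp
  also have "\<dots> \<le> p * (1 - p) * K"
    using p01 by (intro mult_left_mono sum) auto
  finally show ?thesis .
qed

end

section \<open>The mass-transport principle\<close>

context connected_lf_graph
begin

section \<open>Automorphisms acting on edges, balls and stabilizer orbits\<close>

lemma aut_permutes: "\<gamma> \<in> graph_Aut V E \<Longrightarrow> \<gamma> permutes V"
  by (simp add: graph_Aut_def)

lemma aut_inj: "\<gamma> \<in> graph_Aut V E \<Longrightarrow> inj \<gamma>"
  by (rule permutes_inj[OF aut_permutes])

lemma aut_in_V_iff: "\<gamma> \<in> graph_Aut V E \<Longrightarrow> \<gamma> v \<in> V \<longleftrightarrow> v \<in> V"
  by (rule permutes_in_image[OF aut_permutes])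

lemma aut_edge_iff:
  assumes "\<gamma> \<in> graph_Aut V E"
  shows "{\<gamma> u, \<gamma> v} \<in> E \<longleftrightarrow> {u, v} \<in> E"
proof (cases "u \<in> V \<and> v \<in> V")
  case True
  then show ?thesis using assms by (auto simp: graph_Aut_def)
next
  case False
  then show ?thesis
    using edge_subset[of "{u, v}"] edge_subset[of "{\<gamma> u, \<gamma> v}"] aut_in_V_iff[OF assms] by auto
qed

lemma aut_image_edge_iff:
  assumes "\<gamma> \<in> graph_Aut V E"
  shows "\<gamma> ` f \<in> E \<longleftrightarrow> f \<in> E"
proof
  assume f: "f \<in> E"
  then obtain u v where "f = {u, v}" by (rule edge_doubleton)
  then show "\<gamma> ` f \<in> E" using f aut_edge_iff[OF assms, of u v] by simp
next
  assume im: "\<gamma> ` f \<in> E"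
  then obtain a b where ab: "\<gamma> ` f = {a, b}" by (rule edge_doubleton)
  then have "a \<in> \<gamma> ` f" "b \<in> \<gamma> ` f" by auto
  then obtain u v where "a = \<gamma> u" "b = \<gamma> v" by auto
  then have "\<gamma> ` f = \<gamma> ` {u, v}" using ab by simp
  then have f: "f = {u, v}" by (simp only: inj_image_eq_iff[OF aut_inj[OF assms]])
  have "{\<gamma> u, \<gamma> v} \<in> E" using im unfolding f by simp
  then show "f \<in> E" unfolding f by (simp only: aut_edge_iff[OF assms])
qed

lemma aut_inverses:
  "\<gamma> \<in> graph_Aut V E \<Longrightarrow> \<gamma> (inv \<gamma> x) = x" "\<gamma> \<in> graph_Aut V E \<Longrightarrow> inv \<gamma> (\<gamma> x) = x"
  using permutes_inverses[OF aut_permutes] by auto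

lemma aut_inv:
  assumes "\<gamma> \<in> graph_Aut V E"
  shows "inv \<gamma> \<in> graph_Aut V E"
proof -
  have "{inv \<gamma> u, inv \<gamma> v} \<in> E \<longleftrightarrow> {u, v} \<in> E" for u v
    using aut_edge_iff[OF assms, of "inv \<gamma> u" "inv \<gamma> v"] by (simp add: aut_inverses[OF assms])
  then show ?thesis using permutes_inv[OF aut_permutes[OF assms]] by (simp add: graph_Aut_def)
qed

lemma aut_comp:
  assumes "\<gamma> \<in> graph_Aut V E" "\<delta> \<in> graph_Aut V E"
  shows "\<gamma> \<circ> \<delta> \<in> graph_Aut V E"
  using permutes_compose[OF aut_permutes[OF assms(2)] aut_permutes[OF assms(1)]]
    aut_edge_iff[OF assms(1)] aut_edge_iff[OF assms(2)]
  by (simp add: graph_Aut_def)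

lemma aut_ball_iff:
  assumes \<gamma>: "\<gamma> \<in> graph_Aut V E"
  shows "\<gamma> u \<in> graph_ball E r (\<gamma> v) \<longleftrightarrow> u \<in> graph_ball E r v"
proof -
  have fwd: "\<delta> u \<in> graph_ball E r (\<delta> v)"
    if "\<delta> \<in> graph_Aut V E" "u \<in> graph_ball E r v" for \<delta> u v
    using that(2)
  proof (induction r arbitrary: u)
    case (Suc r)
    then show ?case using aut_edge_iff[OF that(1)] by (auto simp: graph_ball_Suc)
  qed simp
  show ?thesis
    using fwd[OF \<gamma>, of u v] fwd[OF aut_inv[OF \<gamma>], of "\<gamma> u" "\<gamma> v"]
    by (auto simp: aut_inverses[OF \<gamma>])
qed

text \<open>The automorphisms that agree with \<open>\<gamma>\<close> at \<open>v\<close> form the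
  left coset of the stabilizer of \<open>v\<close> given by \<open>\<gamma>\<close>.\<close>

lemma Stab_orbit_image:
  assumes \<gamma>: "\<gamma> \<in> graph_Aut V E"
  shows "{\<gamma>' u | \<gamma>'. \<gamma>' \<in> graph_Aut V E \<and> \<gamma>' v = \<gamma> v} = \<gamma> ` Stab_orbit V E v u" (is "?L = ?R")
proof
  show "?L \<subseteq> ?R"
  proof
    fix x assume "x \<in> ?L"
    then obtain \<gamma>' where g: "\<gamma>' \<in> graph_Aut V E" "\<gamma>' v = \<gamma> v" "x = \<gamma>' u" by auto
    have "inv \<gamma> \<circ> \<gamma>' \<in> graph_Stab V E v"
      using g aut_comp[OF aut_inv[OF \<gamma>] g(1)] by (auto simp: graph_Stab_def aut_inverses[OF \<gamma>])
    then have "(inv \<gamma> \<circ> \<gamma>') u \<in> Stab_orbit V E v u" unfolding Stab_orbit_def by blast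
    moreover have "x = \<gamma> ((inv \<gamma> \<circ> \<gamma>') u)" using g by (simp add: aut_inverses[OF \<gamma>])
    ultimately show "x \<in> ?R" by blast
  qed
  show "?R \<subseteq> ?L"
  proof
    fix x assume "x \<in> ?R"
    then obtain \<delta> where d: "\<delta> \<in> graph_Stab V E v" "x = \<gamma> (\<delta> u)" by (auto simp: Stab_orbit_def)
    then have "\<gamma> \<circ> \<delta> \<in> graph_Aut V E" "(\<gamma> \<circ> \<delta>) v = \<gamma> v" "x = (\<gamma> \<circ> \<delta>) u"
      using aut_comp[OF \<gamma>] by (auto simp: graph_Stab_def)
    then show "x \<in> ?L" by blast
  qed
qed

text \<open>The pairs \<open>(a, w)\<close> and \<open>(w', a)\<close> are related when they lie in one diagonal orbit of the
  automorphism group. By unimodularity a vertex has equally many partners on both sides, so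
  the mass sent from \<open>a\<close> to \<open>w\<close> can be spread evenly over the partners \<open>w'\<close>.\<close>

lemma mass_transport:
  fixes F :: "'v \<Rightarrow> 'v \<Rightarrow> real"
  assumes trans: "transitive_graph V E" and unimod: "unimodular_graph V E" and a: "a \<in> V"
    and inv: "\<And>\<gamma> u v. \<gamma> \<in> graph_Aut V E \<Longrightarrow> u \<in> V \<Longrightarrow> v \<in> V \<Longrightarrow> F (\<gamma> u) (\<gamma> v) = F u v"
  shows "(\<Sum>w\<in>graph_ball E r a. F a w) = (\<Sum>w\<in>graph_ball E r a. F w a)"
proof -
  define D where "D = graph_ball E r a"
  define R where "R w w' \<longleftrightarrow> (\<exists>\<gamma>\<in>graph_Aut V E. \<gamma> a = w' \<and> \<gamma> w = a)" for w w'
  define m where "m w = card (Stab_orbit V E w a)" for w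
  have D: "D \<subseteq> V" "finite D"
    using a by (auto simp: D_def finite_graph_ball dest: graph_ball_subset)
  \<comment> \<open>Unimodularity enters here, exchanging the stabilizers of \<open>a\<close> and
    \<open>w\<close>.\<close>
  have um: "card (Stab_orbit V E a w) = m w" if "w \<in> D" for w
    using unimod that a D by (auto simp: unimodular_graph_def m_def)
  have Rsym: "R w w' \<Longrightarrow> R w' w" for w w'
    unfolding R_def using aut_inv aut_inverses by metis
  have RD: "w' \<in> D" if w: "w \<in> D" and Rw: "R w w'" for w w'
  proof -
    obtain \<gamma> where g: "\<gamma> \<in> graph_Aut V E" "\<gamma> a = w'" "\<gamma> w = a" using Rw unfolding R_def by auto
    have "a \<in> graph_ball E r w'" using that aut_ball_iff[OF g(1), of w r a] g by (simp add: D_def)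
    then show ?thesis by (simp add: D_def graph_ball_sym)
  qed
  have cardR: "card {w'. R w w'} = m w" if w: "w \<in> D" for w
  proof -
    obtain \<gamma> where g: "\<gamma> \<in> graph_Aut V E" "\<gamma> w = a"
      using trans w D a unfolding transitive_graph_def by blast
    have "{w'. R w w'} = {\<gamma>' a | \<gamma>'. \<gamma>' \<in> graph_Aut V E \<and> \<gamma>' w = \<gamma> w}"
      using g by (auto simp: R_def)
    also have "\<dots> = \<gamma> ` Stab_orbit V E w a" by (rule Stab_orbit_image[OF g(1)])
    finally show ?thesis
      using card_image[OF inj_on_subset[OF aut_inj[OF g(1)]]] by (simp add: m_def)
  qed
  have Req: "m w = m w'" "F a w = F w' a" if w: "w \<in> D" and Rw: "R w w'" for w w'
  proof -
    obtain \<gamma> where g: "\<gamma> \<in> graph_Aut V E" "\<gamma> a = w'" "\<gamma> w = a" using Rw unfolding R_def by auto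
    show "F a w = F w' a" using inv[OF g(1), of a w] a D that g by auto
    have w': "w' \<in> D" using RD that .
    \<comment> \<open>Since \<open>\<gamma> a = w'\<close> and \<open>\<gamma> w = a\<close>,
      composing with \<open>\<gamma>\<close> on the right turns the stabilizer of \<open>a\<close>
      into the automorphisms sending \<open>w\<close> to \<open>a\<close>, which
      \<open>Stab_orbit_image\<close> describes.\<close>
    have "Stab_orbit V E a w' = \<gamma> ` Stab_orbit V E w a"
    proof
      show "Stab_orbit V E a w' \<subseteq> \<gamma> ` Stab_orbit V E w a"
      proof
        fix x assume "x \<in> Stab_orbit V E a w'"
        then obtain \<delta> where d: "\<delta> \<in> graph_Aut V E" "\<delta> a = a" "x = \<delta> w'"
          by (auto simp: Stab_orbit_def graph_Stab_def)
        then have "\<delta> \<circ> \<gamma> \<in> graph_Aut V E" "(\<delta> \<circ> \<gamma>) w = \<gamma> w" "x = (\<delta> \<circ> \<gamma>) a"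
          using g aut_comp by auto
        then show "x \<in> \<gamma> ` Stab_orbit V E w a"
          unfolding Stab_orbit_image[OF g(1), symmetric] by blast
      qed
      show "\<gamma> ` Stab_orbit V E w a \<subseteq> Stab_orbit V E a w'"
      proof
        fix x assume "x \<in> \<gamma> ` Stab_orbit V E w a"
        then obtain \<gamma>' where h: "\<gamma>' \<in> graph_Aut V E" "\<gamma>' w = \<gamma> w" "x = \<gamma>' a"
          unfolding Stab_orbit_image[OF g(1), symmetric] by blast
        have "inv \<gamma> a = w" "inv \<gamma> w' = a"
          using aut_inverses(2)[OF g(1), of w] aut_inverses(2)[OF g(1), of a] g(2,3) by simp_all
        then have "\<gamma>' \<circ> inv \<gamma> \<in> graph_Stab V E a" "x = (\<gamma>' \<circ> inv \<gamma>) w'"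
          using g(3) h aut_comp[OF h(1) aut_inv[OF g(1)]] by (simp_all add: graph_Stab_def)
        then show "x \<in> Stab_orbit V E a w'" unfolding Stab_orbit_def by blast
      qed
    qed
    then have "card (Stab_orbit V E a w') = m w"
      using card_image[OF inj_on_subset[OF aut_inj[OF g(1)]]] by (simp add: m_def)
    then show "m w = m w'" using um[OF w'] by simp
  qed
  \<comment> \<open>Division by \<open>m w\<close> requires the orbit to be finite as well as
    nonempty, because \<open>card\<close> is 0 on infinite sets. Automorphisms fixing
    \<open>a\<close> preserve the ball around \<open>a\<close>, which is finite.\<close>
  have mpos: "0 < m w" if "w \<in> D" for w
  proof -
    have "Stab_orbit V E a w \<subseteq> D"
    proof
      fix x assume "x \<in> Stab_orbit V E a w"
      then obtain \<delta> where "\<delta> \<in> graph_Aut V E" "\<delta> a = a" "x = \<delta> w"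
        by (auto simp: Stab_orbit_def graph_Stab_def)
      then show "x \<in> D" using aut_ball_iff[of \<delta> w r a] that by (simp add: D_def)
    qed
    then have "finite (Stab_orbit V E a w)" using D finite_subset by auto
    moreover have "id \<in> graph_Stab V E a"
      by (auto simp: graph_Stab_def graph_Aut_def permutes_id)
    then have "id w \<in> Stab_orbit V E a w" unfolding Stab_orbit_def by blast
    then have "w \<in> Stab_orbit V E a w" by simp
    ultimately have "0 < card (Stab_orbit V E a w)" by (auto simp: card_gt_0_iff)
    then show ?thesis using um[OF that] by simp
  qed
  have RDset: "{w' \<in> D. R w w'} = {w'. R w w'}" if "w \<in> D" for w
    using RD that by auto
  have "(\<Sum>w\<in>D. F a w) = (\<Sum>w\<in>D. \<Sum>w'\<in>{w' \<in> D. R w w'}. F w' a / m w')"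
  proof (rule sum.cong[OF refl])
    fix w assume w: "w \<in> D"
    have "(\<Sum>w'\<in>{w' \<in> D. R w w'}. F w' a / m w') = (\<Sum>w'\<in>{w' \<in> D. R w w'}. F a w / m w)"
      using Req[OF w] by (intro sum.cong) auto
    also have "\<dots> = F a w" using cardR[OF w] RDset[OF w] mpos[OF w] by simp
    finally show "F a w = (\<Sum>w'\<in>{w' \<in> D. R w w'}. F w' a / m w')" by simp
  qed
  \<comment> \<open>By symmetry of \<open>R\<close>, each \<open>w'\<close> collects
    \<open>m w'\<close> shares, each of them a fraction \<open>1 / m w'\<close> of its mass.\<close>
  also have "\<dots> = (\<Sum>w'\<in>D. \<Sum>w\<in>{w \<in> D. R w w'}. F w' a / m w')"
    by (rule sum.swap_restrict[OF D(2) D(2)])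
  also have "\<dots> = (\<Sum>w'\<in>D. F w' a)"
  proof (rule sum.cong[OF refl])
    fix w' assume w': "w' \<in> D"
    have "{w \<in> D. R w w'} = {w. R w' w}" using Rsym RD w' by blast
    then show "(\<Sum>w\<in>{w \<in> D. R w w'}. F w' a / m w') = F w' a"
      using cardR[OF w'] mpos[OF w'] by simp
  qed
  finally show ?thesis by (simp add: D_def)
qed

end

section \<open>Invariance of percolation under automorphisms\<close>

context edge_percolation
begin

text \<open>The pullback of a configuration; restricting it to \<open>E\<close> keeps it a point of
  the extensional product space.\<close>

definition relabel :: "('v \<Rightarrow> 'v) \<Rightarrow> ('v set \<Rightarrow> bool) \<Rightarrow> 'v set \<Rightarrow> bool" where
  "relabel \<gamma> w = (\<lambda>f\<in>E. w (\<gamma> ` f))"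

text \<open>An automorphism permutes the edges, whose states are independent and identically
  distributed.\<close>

lemma expectation_relabel:
  fixes G :: "('v set \<Rightarrow> bool) \<Rightarrow> real"
  assumes \<gamma>: "\<gamma> \<in> graph_Aut V E" and G: "G \<in> borel_measurable BP"
  shows "(\<integral>w. G (relabel \<gamma> w) \<partial>BP) = (\<integral>w. G w \<partial>BP)"
proof -
  have inj: "inj_on ((`) \<gamma>) E"
    using aut_inj[OF \<gamma>] by (auto simp: inj_on_def inj_image_eq_iff)
  have eq: "distr BP BP (relabel \<gamma>) = BP"
    using distr_PiM_reindex[OF _ inj, of E "\<lambda>_. measure_pmf (bernoulli_pmf p)"] aut_image_edge_iff[OF \<gamma>]
    by (simp add: bernoulli_percolation_def relabel_def[abs_def] measure_pmf.prob_space_axioms)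
  have "relabel \<gamma> \<in> measurable BP BP"
    by (rule measurable_into_BP) (auto simp: relabel_def aut_image_edge_iff[OF \<gamma>])
  from integral_distr[OF this G] show ?thesis by (simp add: eq)
qed

lemma cluster_relabel:
  assumes \<gamma>: "\<gamma> \<in> graph_Aut V E"
  shows "cluster E w (\<gamma> v) = \<gamma> ` cluster E (relabel \<gamma> w) v"
proof
  show "cluster E w (\<gamma> v) \<subseteq> \<gamma> ` cluster E (relabel \<gamma> w) v"
    unfolding cluster_def
  proof (rule graph_component_least)
    fix x y assume x: "x \<in> \<gamma> ` graph_component {f \<in> E. relabel \<gamma> w f} v"
      and xy: "{x, y} \<in> {f \<in> E. w f}"
    then obtain x' where x': "x = \<gamma> x'" "x' \<in> graph_component {f \<in> E. relabel \<gamma> w f} v" by auto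
    obtain y' where y': "y = \<gamma> y'" using aut_inverses(1)[OF \<gamma>, of y] by (metis)
    have "{x', y'} \<in> {f \<in> E. relabel \<gamma> w f}"
      using xy x' y' aut_edge_iff[OF \<gamma>] by (auto simp: relabel_def)
    with x'(2) have "y' \<in> graph_component {f \<in> E. relabel \<gamma> w f} v" by (rule graph_component_step)
    then show "y \<in> \<gamma> ` graph_component {f \<in> E. relabel \<gamma> w f} v" using y' by simp
  qed simp
  have "cluster E (relabel \<gamma> w) v \<subseteq> {x. \<gamma> x \<in> cluster E w (\<gamma> v)}"
    unfolding cluster_def
  proof (rule graph_component_least)
    fix x y assume x: "x \<in> {x. \<gamma> x \<in> graph_component {f \<in> E. w f} (\<gamma> v)}"
      and xy: "{x, y} \<in> {f \<in> E. relabel \<gamma> w f}"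
    then have "{\<gamma> x, \<gamma> y} \<in> {f \<in> E. w f}"
      using aut_edge_iff[OF \<gamma>] by (auto simp: relabel_def)
    with x show "y \<in> {x. \<gamma> x \<in> graph_component {f \<in> E. w f} (\<gamma> v)}"
      by (auto intro: graph_component_step)
  qed simp
  then show "\<gamma> ` cluster E (relabel \<gamma> w) v \<subseteq> cluster E w (\<gamma> v)" by auto
qed

section \<open>The two-cluster event\<close>

definition cluster_mass :: "nat \<Rightarrow> nat \<Rightarrow> 'v set \<Rightarrow> real" where
  "cluster_mass n r C = (if small_set r C then min (card (touching_edges E C)) n / n else 0)"

definition vertex_mass :: "nat \<Rightarrow> nat \<Rightarrow> 'v set \<Rightarrow> real" where
  "vertex_mass n r C = cluster_mass n r C / card C"

text \<open>The total mass of the clusters touching the edge \<open>{x, y}\<close>.\<close>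

definition edge_mass :: "nat \<Rightarrow> nat \<Rightarrow> 'v \<Rightarrow> 'v \<Rightarrow> ('v set \<Rightarrow> bool) \<Rightarrow> real" where
  "edge_mass n r x y w = cluster_mass n r (cluster E w x)
     + (if y \<in> cluster E w x then 0 else cluster_mass n r (cluster E w y))"

text \<open>Vertex \<open>u\<close> owns an equal share of the mass of its cluster and sends it,
  multiplied by scores, to the endpoints of the touching edges. Summed over \<open>v\<close> this
  counts every touching edge twice; summed over \<open>u\<close> it rebuilds the edge masses at
  \<open>v\<close>.\<close>

definition transport :: "nat \<Rightarrow> nat \<Rightarrow> 'v \<Rightarrow> 'v \<Rightarrow> ('v set \<Rightarrow> bool) \<Rightarrow> real" where
  "transport n r u v w = vertex_mass n r (cluster E w u) *
     (\<Sum>f\<in>{f \<in> incident_edges E v. f \<inter> cluster E w u \<noteq> {}}. edge_score w f)"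

lemma finite_incident: "v \<in> V \<Longrightarrow> finite (incident_edges E v)"
  using lf by (auto simp: locally_finite_graph_def)

lemma cluster_mass_bounds: "0 \<le> cluster_mass n r C" "cluster_mass n r C \<le> 1"
  by (cases "n = 0"; auto simp: cluster_mass_def)+

lemma cluster_mass_eq_1:
  assumes "small_set r C" "C \<noteq> {}" "touches_at_least E n C" "1 \<le> n"
  shows "cluster_mass n r C = 1"
  using assms small_set_touching(3)[of r C] by (auto simp: cluster_mass_def touches_at_least_def min_def)

lemma small_set_subset: "small_set r C \<Longrightarrow> D \<subseteq> C \<Longrightarrow> small_set r D"
  unfolding small_set_def by blast

lemma touching_edges_Un: "touching_edges E (C \<union> D) = touching_edges E C \<union> touching_edges E D"
  by (auto simp: touching_edges_def)

text \<open>If the union is small, so are both parts, and capping at \<open>n\<close> preserves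
  subadditivity of the edge count; otherwise the union has mass 0.\<close>

lemma cluster_mass_Un_le: "cluster_mass n r (C \<union> D) \<le> cluster_mass n r C + cluster_mass n r D"
proof (cases "small_set r (C \<union> D)")
  case True
  have "min (card (touching_edges E (C \<union> D))) n
      \<le> min (card (touching_edges E C)) n + min (card (touching_edges E D)) n"
    using card_Un_le[of "touching_edges E C" "touching_edges E D"] by (simp add: touching_edges_Un)
  then have "real (min (card (touching_edges E (C \<union> D))) n) / n
      \<le> real (min (card (touching_edges E C)) n + min (card (touching_edges E D)) n) / n"
    by (intro divide_right_mono of_nat_mono) auto
  moreover have "small_set r C" "small_set r D" using small_set_subset[OF True] by auto
  ultimately show ?thesis using True by (simp add: cluster_mass_def add_divide_distrib)
next
  case False
  then show ?thesis using cluster_mass_bounds(1)[of n r C] cluster_mass_bounds(1)[of n r D]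
    by (simp add: cluster_mass_def)
qed

lemma measurable_cluster_mass [measurable]:
  "v \<in> V \<Longrightarrow> (\<lambda>w. cluster_mass n r (cluster E w v)) \<in> borel_measurable BP"
  by (rule borel_measurable_cluster[where H="\<lambda>C w. cluster_mass n r C"])
     (auto simp: cluster_mass_def dest: small_set_finite)

lemma measurable_edge_mass [measurable]:
  assumes [measurable]: "x \<in> V" "y \<in> V"
  shows "edge_mass n r x y \<in> borel_measurable BP"
  unfolding edge_mass_def[abs_def] by measurable

lemma abs_edge_mass_le: "\<bar>edge_mass n r x y w\<bar> \<le> 2"
  using cluster_mass_bounds[of n r "cluster E w x"] cluster_mass_bounds[of n r "cluster E w y"]
  by (auto simp: edge_mass_def)

lemma cluster_eq: "u \<in> cluster E w v \<Longrightarrow> cluster E w u = cluster E w v"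
  unfolding cluster_def by (rule graph_component_eq)

lemma cluster_sym: "u \<in> cluster E w v \<Longrightarrow> v \<in> cluster E w u"
  unfolding cluster_def by (rule graph_component_sym)

lemma cluster_open_edge:
  assumes "{x, y} \<in> E"
  shows "cluster E (w({x, y} := True)) x
    = cluster E (w({x, y} := False)) x \<union> cluster E (w({x, y} := False)) y"
proof -
  have "{f \<in> E. (w({x, y} := True)) f} = insert {x, y} {f \<in> E. (w({x, y} := False)) f}"
    using assms by auto
  then show ?thesis by (simp only: cluster_def graph_component_insert_edge)
qed

lemma edge_mass_open:
  assumes "{x, y} \<in> E"
  shows "edge_mass n r x y (w({x, y} := True)) = cluster_mass n r
    (cluster E (w({x, y} := False)) x \<union> cluster E (w({x, y} := False)) y)"
proof -
  have "y \<in> cluster E (w({x, y} := True)) x" by (simp add: cluster_open_edge[OF assms])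
  then show ?thesis by (simp add: edge_mass_def cluster_open_edge[OF assms])
qed

lemma edge_mass_update_le:
  assumes "{x, y} \<in> E"
  shows "edge_mass n r x y (w({x, y} := True)) \<le> edge_mass n r x y (w({x, y} := False))"
  unfolding edge_mass_open[OF assms] edge_mass_def[of n r x y "w({x, y} := False)"]
  using cluster_mass_Un_le[of n r "cluster E (w({x, y} := False)) x" "cluster E (w({x, y} := False)) y"]
    cluster_eq[of y "w({x, y} := False)" x] by auto

text \<open>If both clusters are small, two units of mass merge into at most one. If just one is
  small, its unit is lost, as the union is not small and has mass 0.\<close>

lemma edge_mass_gap:
  assumes "{x, y} \<in> E" and w: "w({x, y} := False) = w"
    and "cluster E w x \<noteq> cluster E w y" "1 \<le> n"
    and "touches_at_least E n (cluster E w x)" "touches_at_least E n (cluster E w y)"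
    and "small_set r (cluster E w x) \<or> small_set r (cluster E w y)"
  shows "1 \<le> edge_mass n r x y (w({x, y} := False)) - edge_mass n r x y (w({x, y} := True))"
proof -
  let ?A = "cluster E w x" and ?B = "cluster E w y"
  have y: "y \<notin> ?A" using assms(3) cluster_eq by metis
  have "?A \<noteq> {}" "?B \<noteq> {}" using cluster_self by blast+
  then have "small_set r ?A \<Longrightarrow> cluster_mass n r ?A = 1" "small_set r ?B \<Longrightarrow> cluster_mass n r ?B = 1"
    using assms cluster_mass_eq_1 by blast+
  moreover have "cluster_mass n r (?A \<union> ?B) = 0" if "\<not> small_set r ?A \<or> \<not> small_set r ?B"
    using that small_set_subset[of r "?A \<union> ?B"] by (auto simp: cluster_mass_def)
  ultimately have "1 + cluster_mass n r (?A \<union> ?B) \<le> cluster_mass n r ?A + cluster_mass n r ?B"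
    using assms(7) cluster_mass_bounds[of n r ?A] cluster_mass_bounds[of n r ?B]
      cluster_mass_bounds(2)[of n r "?A \<union> ?B"] by (cases "small_set r ?A"; cases "small_set r ?B") auto
  then show ?thesis
    using y unfolding edge_mass_open[OF assms(1)] w by (simp add: edge_mass_def)
qed

text \<open>On resampling the edge, the open and closed configurations receive the opposite weights
  \<open>p (p - 1)\<close> and \<open>(1 - p) p\<close>.\<close>

lemma expectation_score_edge_mass:
  assumes e: "{x, y} \<in> E"
  shows "(\<integral>w. edge_score w {x, y} * edge_mass n r x y w \<partial>BP) =
    p * (1 - p) * (\<integral>w. edge_mass n r x y (w({x, y} := False)) - edge_mass n r x y (w({x, y} := True)) \<partial>BP)"
proof -
  have xy [measurable]: "x \<in> V" "y \<in> V" and [measurable]: "{x, y} \<in> E" using edge_subset[OF e] e by auto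
  have int: "integrable BP (\<lambda>w. edge_mass n r x y (w({x, y} := b)))" for b
    by (rule BP.integrable_const_bound[of _ 2]) (auto simp: abs_edge_mass_le)
  have bound: "\<bar>edge_score w {x, y} * edge_mass n r x y w\<bar> \<le> 2" for w
    using mult_mono[OF abs_edge_score_le abs_edge_mass_le] by (simp add: abs_mult)
  have "(\<integral>w. edge_score w {x, y} * edge_mass n r x y w \<partial>BP) =
      p * (\<integral>w. edge_score (w({x, y} := True)) {x, y} * edge_mass n r x y (w({x, y} := True)) \<partial>BP)
      + (1 - p) * (\<integral>w. edge_score (w({x, y} := False)) {x, y} * edge_mass n r x y (w({x, y} := False)) \<partial>BP)"
    by (rule expectation_resample[OF e _ bound]) measurable
  also have "\<dots> = p * (\<integral>w. (p - 1) * edge_mass n r x y (w({x, y} := True)) \<partial>BP)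
      + (1 - p) * (\<integral>w. p * edge_mass n r x y (w({x, y} := False)) \<partial>BP)"
    by (simp only: edge_score_def fun_upd_same if_True if_False)
  also have "\<dots> = p * (1 - p) * (\<integral>w. edge_mass n r x y (w({x, y} := False)) - edge_mass n r x y (w({x, y} := True)) \<partial>BP)"
    unfolding Bochner_Integration.integral_diff[OF int int] integral_mult_right_zero
    by (simp add: algebra_simps)
  finally show ?thesis .
qed

text \<open>Lets a single edge be bounded by the sum over all edges at a vertex, the quantity that
  mass transport can handle.\<close>

lemma expectation_score_edge_mass_nonneg:
  assumes "{x, y} \<in> E"
  shows "0 \<le> (\<integral>w. edge_score w {x, y} * edge_mass n r x y w \<partial>BP)"
  unfolding expectation_score_edge_mass[OF assms] using p01 edge_mass_update_le[OF assms]
  by (intro mult_nonneg_nonneg Bochner_Integration.integral_nonneg) auto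

text \<open>A truncated substitute for \<open>two_cluster_event\<close>, phrased through the mass so
  that it is measurable and directly fits a Markov bound.\<close>

definition pivotal_event :: "nat \<Rightarrow> nat \<Rightarrow> 'v \<Rightarrow> 'v \<Rightarrow> ('v set \<Rightarrow> bool) set" where
  "pivotal_event n r x y = {w \<in> space BP. \<not> w {x, y} \<and>
     1 \<le> edge_mass n r x y (w({x, y} := False)) - edge_mass n r x y (w({x, y} := True))}"

lemma sets_pivotal_event:
  assumes e: "{x, y} \<in> E"
  shows "pivotal_event n r x y \<in> sets BP"
proof -
  have [measurable]: "x \<in> V" "y \<in> V" "{x, y} \<in> E" using edge_subset[OF e] e by auto
  show ?thesis unfolding pivotal_event_def by measurable
qed

text \<open>The size of the gap does not depend on the state of the edge itself. Hence the
  probability is \<open>1 - p\<close> times that of a gap of at least 1, and Markov's inequality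
  applies because the gap is nonnegative.\<close>

lemma prob_pivotal_event_le:
  assumes e: "{x, y} \<in> E"
  shows "p * measure BP (pivotal_event n r x y) \<le> (\<integral>w. edge_score w {x, y} * edge_mass n r x y w \<partial>BP)"
proof -
  have [measurable]: "x \<in> V" "y \<in> V" "{x, y} \<in> E" using edge_subset[OF e] e by auto
  note sets_pivotal_event[OF e, measurable]
  let ?S = "pivotal_event n r x y"
  let ?D = "\<lambda>w. edge_mass n r x y (w({x, y} := False)) - edge_mass n r x y (w({x, y} := True))"
  have int: "integrable BP (\<lambda>w. edge_mass n r x y (w({x, y} := b)))" for b
    by (rule BP.integrable_const_bound[of _ 2]) (auto simp: abs_edge_mass_le)
  have zero: "(\<integral>w. indicator ?S (w({x, y} := True)) \<partial>BP) = (0 :: real)"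
    by (rule integral_eq_zero_AE) (auto simp: pivotal_event_def)
  have "measure BP ?S = (\<integral>w. indicator ?S w \<partial>BP)" by simp
  also have "\<dots> = p * (\<integral>w. indicator ?S (w({x, y} := True)) \<partial>BP)
      + (1 - p) * (\<integral>w. indicator ?S (w({x, y} := False)) \<partial>BP)"
    by (rule expectation_resample[OF e, of _ 1]) (auto simp: indicator_def)
  also have "\<dots> = (1 - p) * (\<integral>w. indicator ?S (w({x, y} := False)) \<partial>BP)"
    unfolding zero by (simp only: mult_zero_right add_0)
  also have "\<dots> \<le> (1 - p) * (\<integral>w. ?D w \<partial>BP)"
  proof (intro mult_left_mono integral_mono)
    show "integrable BP (\<lambda>w. indicator ?S (w({x, y} := False)) :: real)"
      by (rule BP.integrable_const_bound[of _ 1]) (auto simp: indicator_def)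
    show "integrable BP ?D" using int by auto
    show "indicator ?S (w({x, y} := False)) \<le> ?D w" if "w \<in> space BP" for w
      using edge_mass_update_le[OF e, of n r w] by (auto simp: indicator_def pivotal_event_def)
  qed (use p01 in auto)
  finally have "p * measure BP ?S \<le> p * ((1 - p) * (\<integral>w. ?D w \<partial>BP))"
    using p01 by (intro mult_left_mono) auto
  then show ?thesis unfolding expectation_score_edge_mass[OF e] by (simp add: mult.assoc)
qed

text \<open>All ingredients are defined from the graph alone. With
  \<open>expectation_relabel\<close> this makes the expected transport diagonally invariant.\<close>

lemma transport_relabel:
  assumes \<gamma>: "\<gamma> \<in> graph_Aut V E"
  shows "transport n r (\<gamma> u) (\<gamma> v) w = transport n r u v (relabel \<gamma> w)"
proof -
  let ?C = "cluster E (relabel \<gamma> w) u"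
  note inj = aut_inj[OF \<gamma>]
  have E: "\<gamma> ` f \<in> E \<longleftrightarrow> f \<in> E" for f by (rule aut_image_edge_iff[OF \<gamma>])
  have ex: "\<exists>f'. f = \<gamma> ` f'" for f
  proof
    show "f = \<gamma> ` (inv \<gamma> ` f)" by (simp add: image_image aut_inverses[OF \<gamma>])
  qed
  have injE: "inj_on ((`) \<gamma>) S" for S
    using inj by (auto simp: inj_on_def inj_image_eq_iff)
  have T: "touching_edges E (\<gamma> ` C) = (`) \<gamma> ` touching_edges E C" for C
  proof (rule set_eqI)
    fix f obtain f' where f: "f = \<gamma> ` f'" using ex by blast
    show "f \<in> touching_edges E (\<gamma> ` C) \<longleftrightarrow> f \<in> (`) \<gamma> ` touching_edges E C"
      unfolding f inj_image_mem_iff[OF injE[of UNIV]]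
      by (simp add: touching_edges_def E image_Int[OF inj, symmetric])
  qed
  have "small_set r (\<gamma> ` C) \<longleftrightarrow> small_set r C" for C
    by (simp add: small_set_def image_subset_iff aut_in_V_iff[OF \<gamma>] aut_ball_iff[OF \<gamma>] subset_eq)
  then have mass: "vertex_mass n r (\<gamma> ` ?C) = vertex_mass n r ?C"
    by (simp add: vertex_mass_def cluster_mass_def T card_image[OF injE] card_image[OF inj_on_subset[OF inj]])
  have "{f \<in> incident_edges E (\<gamma> v). f \<inter> \<gamma> ` ?C \<noteq> {}}
      = (`) \<gamma> ` {f \<in> incident_edges E v. f \<inter> ?C \<noteq> {}}" (is "?L = ?R")
  proof (rule set_eqI)
    fix f obtain f' where f: "f = \<gamma> ` f'" using ex by blast
    show "f \<in> ?L \<longleftrightarrow> f \<in> ?R"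
      unfolding f inj_image_mem_iff[OF injE[of UNIV]]
      by (simp add: incident_edges_def E image_Int[OF inj, symmetric] inj_image_mem_iff[OF inj])
  qed
  then have "(\<Sum>f\<in>{f \<in> incident_edges E (\<gamma> v). f \<inter> \<gamma> ` ?C \<noteq> {}}. edge_score w f)
      = (\<Sum>f\<in>{f \<in> incident_edges E v. f \<inter> ?C \<noteq> {}}. edge_score w (\<gamma> ` f))"
    by (simp add: sum.reindex[OF injE])
  also have "\<dots> = (\<Sum>f\<in>{f \<in> incident_edges E v. f \<inter> ?C \<noteq> {}}. edge_score (relabel \<gamma> w) f)"
    by (intro sum.cong) (auto simp: edge_score_def relabel_def incident_edges_def)
  finally show ?thesis by (simp add: transport_def cluster_relabel[OF \<gamma>] mass)
qed

lemma abs_vertex_mass_le: "\<bar>vertex_mass n r C\<bar> \<le> 1"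
proof (cases "card C = 0")
  case False
  then have "1 \<le> real (card C)" by simp
  then show ?thesis using cluster_mass_bounds[of n r C]
    by (auto simp: vertex_mass_def divide_le_eq)
qed (simp add: vertex_mass_def)

lemma measurable_transport:
  assumes "u \<in> V" "v \<in> V"
  shows "transport n r u v \<in> borel_measurable BP"
  unfolding transport_def[abs_def]
proof (rule borel_measurable_cluster[OF assms(1), where H="\<lambda>C w. vertex_mass n r C *
     (\<Sum>f\<in>{f \<in> incident_edges E v. f \<inter> C \<noteq> {}}. edge_score w f)"])
  show "(\<lambda>w. vertex_mass n r C * (\<Sum>f\<in>{f \<in> incident_edges E v. f \<inter> C \<noteq> {}}. edge_score w f))
      \<in> borel_measurable BP" for C
    by (intro borel_measurable_times borel_measurable_const borel_measurable_sum measurable_edge_score)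
       (auto simp: incident_edges_def)
qed (auto simp: vertex_mass_def)

lemma integrable_transport:
  assumes "u \<in> V" "v \<in> V"
  shows "integrable BP (transport n r u v)"
proof (rule BP.integrable_const_bound[of _ "card (incident_edges E v)"])
  have "\<bar>transport n r u v w\<bar> \<le> card (incident_edges E v)" for w
  proof -
    let ?I = "{f \<in> incident_edges E v. f \<inter> cluster E w u \<noteq> {}}"
    have "\<bar>\<Sum>f\<in>?I. edge_score w f\<bar> \<le> (\<Sum>f\<in>?I. \<bar>edge_score w f\<bar>)" by (rule sum_abs)
    also have "\<dots> \<le> (\<Sum>f\<in>?I. 1)" by (intro sum_mono abs_edge_score_le)
    also have "\<dots> = card ?I" by simp
    also have "\<dots> \<le> card (incident_edges E v)"
      using card_mono[OF finite_incident[OF assms(2)], of ?I] by auto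
    finally show ?thesis
      using mult_mono[OF abs_vertex_mass_le] by (fastforce simp: transport_def abs_mult)
  qed
  then show "AE w in BP. norm (transport n r u v w) \<le> card (incident_edges E v)" by simp
qed (rule measurable_transport[OF assms])

text \<open>The factor 2 counts the endpoints of a touching edge. One of them lies in the cluster,
  within distance \<open>r\<close> of \<open>a\<close>, and the other may be one step further, hence
  the radius \<open>Suc r\<close>.\<close>

lemma sum_transport_out:
  assumes a: "a \<in> V"
  shows "(\<Sum>v\<in>graph_ball E (Suc r) a. transport n r a v w)
    = 2 * vertex_mass n r (cluster E w a) * fluctuation (cluster E w a) w"
proof (cases "small_set r (cluster E w a)")
  case True
  let ?C = "cluster E w a" and ?D = "graph_ball E (Suc r) a"
  let ?T = "touching_edges E ?C"
  have finT: "finite ?T" using small_set_touching(3)[OF True cluster_self] .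
  have D: "finite ?D" "?D \<subseteq> V" using a by (auto intro: finite_graph_ball dest: graph_ball_subset)
  have CD: "?C \<subseteq> graph_ball E r a" using True by (auto simp: small_set_def)
  have "(\<Sum>v\<in>?D. \<Sum>f\<in>{f \<in> incident_edges E v. f \<inter> ?C \<noteq> {}}. edge_score w f)
      = (\<Sum>v\<in>?D. \<Sum>f\<in>{f \<in> ?T. v \<in> f}. edge_score w f)"
    by (intro sum.cong) (auto simp: incident_edges_def touching_edges_def)
  also have "\<dots> = (\<Sum>f\<in>?T. \<Sum>v\<in>{v \<in> ?D. v \<in> f}. edge_score w f)"
    by (rule sum.swap_restrict[OF D(1) finT])
  also have "\<dots> = (\<Sum>f\<in>?T. 2 * edge_score w f)"
  proof (rule sum.cong[OF refl])
    fix f assume f: "f \<in> ?T"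
    then obtain x where x: "x \<in> f" "x \<in> ?C" "f \<in> E" by (auto simp: touching_edges_def)
    then obtain y where y: "f = {x, y}" by (metis edge_at)
    then have "f \<subseteq> ?D" using x CD by (auto simp: graph_ball_Suc)
    then have "{v \<in> ?D. v \<in> f} = f" by auto
    then show "(\<Sum>v\<in>{v \<in> ?D. v \<in> f}. edge_score w f) = 2 * edge_score w f"
      using edge_card[OF x(3)] by simp
  qed
  finally show ?thesis
    by (simp add: transport_def fluctuation_def sum_distrib_left[symmetric])
next
  case False
  then show ?thesis by (simp add: transport_def vertex_mass_def cluster_mass_def)
qed

lemma sum_vertex_mass:
  assumes "graph_ball E r y \<subseteq> D"
  shows "(\<Sum>u\<in>{u \<in> D. u \<in> cluster E w y}. vertex_mass n r (cluster E w u)) = cluster_mass n r (cluster E w y)"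
proof (cases "small_set r (cluster E w y)")
  case True
  have "{u \<in> D. u \<in> cluster E w y} = cluster E w y"
    using True assms cluster_self[of y w] unfolding small_set_def by blast
  moreover have "card (cluster E w y) \<noteq> 0"
    using small_set_finite[OF True] cluster_self[of y w] card_0_eq by blast
  moreover have "(\<Sum>u\<in>cluster E w y. vertex_mass n r (cluster E w u))
      = (\<Sum>u\<in>cluster E w y. vertex_mass n r (cluster E w y))"
    by (intro sum.cong) (auto simp: cluster_eq)
  ultimately show ?thesis by (simp add: vertex_mass_def)
next
  case False
  then have "vertex_mass n r (cluster E w u) = 0" if "u \<in> cluster E w y" for u
    using that by (simp add: cluster_eq vertex_mass_def cluster_mass_def)
  then show ?thesis using False by (simp add: cluster_mass_def)
qed

text \<open>The senders through \<open>{a, y}\<close> are the vertices of the clusters of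
  \<open>a\<close> and \<open>y\<close>, whose shares add up to the edge mass. Radius
  \<open>Suc r\<close> covers the ball of radius \<open>r\<close> around the neighbour
  \<open>y\<close>.\<close>

lemma sum_transport_in:
  assumes a: "a \<in> V"
  shows "(\<Sum>u\<in>graph_ball E (Suc r) a. transport n r u a w)
    = (\<Sum>y\<in>{y. {a, y} \<in> E}. edge_score w {a, y} * edge_mass n r a y w)"
proof -
  let ?D = "graph_ball E (Suc r) a" and ?I = "incident_edges E a"
  let ?m = "\<lambda>u. vertex_mass n r (cluster E w u)"
  have D: "finite ?D" using a by (rule finite_graph_ball)
  have "(\<Sum>u\<in>?D. transport n r u a w)
      = (\<Sum>u\<in>?D. \<Sum>f\<in>{f \<in> ?I. f \<inter> cluster E w u \<noteq> {}}. ?m u * edge_score w f)"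
    by (simp add: transport_def sum_distrib_left)
  also have "\<dots> = (\<Sum>f\<in>?I. \<Sum>u\<in>{u \<in> ?D. f \<inter> cluster E w u \<noteq> {}}. ?m u * edge_score w f)"
    by (rule sum.swap_restrict[OF D finite_incident[OF a]])
  also have "\<dots> = (\<Sum>y\<in>{y. {a, y} \<in> E}.
      \<Sum>u\<in>{u \<in> ?D. {a, y} \<inter> cluster E w u \<noteq> {}}. ?m u * edge_score w {a, y})"
  proof (rule sum.reindex_cong[where l="\<lambda>y. {a, y}"])
    show "inj_on (\<lambda>y. {a, y}) {y. {a, y} \<in> E}" by (auto simp: inj_on_def doubleton_eq_iff)
    show "?I = (\<lambda>y. {a, y}) ` {y. {a, y} \<in> E}"
      by (auto simp: incident_edges_def image_iff) (metis edge_at)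
  qed auto
  also have "\<dots> = (\<Sum>y\<in>{y. {a, y} \<in> E}. edge_score w {a, y} * edge_mass n r a y w)"
  proof (rule sum.cong[OF refl])
    fix y assume "y \<in> {y. {a, y} \<in> E}"
    then have ay: "{a, y} \<in> E" by simp
    have sub: "graph_ball E r a \<subseteq> ?D" "graph_ball E r y \<subseteq> ?D"
    proof -
      show "graph_ball E r a \<subseteq> ?D" by (auto simp: graph_ball_Suc)
      show "graph_ball E r y \<subseteq> ?D"
      proof
        fix u assume "u \<in> graph_ball E r y"
        then have "y \<in> graph_ball E r u" by (simp add: graph_ball_sym)
        then have "a \<in> graph_ball E (Suc r) u" using ay by (auto simp: graph_ball_Suc insert_commute)
        then show "u \<in> ?D" by (simp add: graph_ball_sym)
      qed
    qed
    let ?A = "{u \<in> ?D. u \<in> cluster E w a}" and ?B = "{u \<in> ?D. u \<in> cluster E w y}"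
    have iff: "b \<in> cluster E w u \<longleftrightarrow> u \<in> cluster E w b" for b u
      using cluster_sym by blast
    have eq: "{u \<in> ?D. {a, y} \<inter> cluster E w u \<noteq> {}} = ?A \<union> ?B"
      using iff by auto
    have "(\<Sum>u\<in>?A \<union> ?B. ?m u) = edge_mass n r a y w"
    proof (cases "y \<in> cluster E w a")
      case True
      then have "?A \<union> ?B = ?A" using cluster_eq by auto
      then show ?thesis using True sum_vertex_mass[OF sub(1)] by (simp add: edge_mass_def)
    next
      case False
      then have "?A \<inter> ?B = {}" using cluster_eq cluster_self by blast
      then have "(\<Sum>u\<in>?A \<union> ?B. ?m u) = (\<Sum>u\<in>?A. ?m u) + (\<Sum>u\<in>?B. ?m u)"
        using D by (intro sum.union_disjoint) auto
      then show ?thesis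
        using False sum_vertex_mass[OF sub(1)] sum_vertex_mass[OF sub(2)]
        by (simp add: edge_mass_def)
    qed
    then show "(\<Sum>u\<in>{u \<in> ?D. {a, y} \<inter> cluster E w u \<noteq> {}}. ?m u * edge_score w {a, y})
        = edge_score w {a, y} * edge_mass n r a y w"
      unfolding eq sum_distrib_right[symmetric] by simp
  qed
  finally show ?thesis .
qed

lemma prob_pivotal_le_fluctuation:
  assumes trans: "transitive_graph V E" and unimod: "unimodular_graph V E"
    and e: "{a, b} \<in> E"
  shows "p * measure BP (pivotal_event n r a b)
    \<le> 2 * (\<integral>w. vertex_mass n r (cluster E w a) * fluctuation (cluster E w a) w \<partial>BP)"
proof -
  have a: "a \<in> V" using edge_subset[OF e] by simp
  let ?D = "graph_ball E (Suc r) a" and ?N = "{y. {a, y} \<in> E}"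
  have D: "?D \<subseteq> V" using a by (rule graph_ball_subset)
  define F where "F u v = (\<integral>w. transport n r u v w \<partial>BP)" for u v
  have inv: "F (\<gamma> u) (\<gamma> v) = F u v" if "\<gamma> \<in> graph_Aut V E" "u \<in> V" "v \<in> V" for \<gamma> u v
    using expectation_relabel[OF that(1) measurable_transport[OF that(2,3)]]
    by (simp add: F_def transport_relabel[OF that(1)])
  have finN: "finite ?N"
  proof (rule finite_subset)
    show "?N \<subseteq> graph_ball E 1 a" using graph_ball_Suc[of E 0 a] by auto
  qed (rule finite_graph_ball[OF a])
  have int: "integrable BP (\<lambda>w. edge_score w {a, y} * edge_mass n r a y w)" if "y \<in> ?N" for y
  proof (rule BP.integrable_const_bound[of _ 2])
    have "\<bar>edge_score w {a, y} * edge_mass n r a y w\<bar> \<le> 2" for w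
      using mult_mono[OF abs_edge_score_le abs_edge_mass_le] by (simp add: abs_mult)
    then show "AE w in BP. norm (edge_score w {a, y} * edge_mass n r a y w) \<le> 2" by simp
    have [measurable]: "{a, y} \<in> E" "y \<in> V" "a \<in> V" using that edge_subset by auto
    show "(\<lambda>w. edge_score w {a, y} * edge_mass n r a y w) \<in> borel_measurable BP" by measurable
  qed
  have "p * measure BP (pivotal_event n r a b) \<le> (\<integral>w. edge_score w {a, b} * edge_mass n r a b w \<partial>BP)"
    by (rule prob_pivotal_event_le[OF e])
  \<comment> \<open>The other edges at \<open>a\<close> contribute nonnegative terms.\<close>
  also have "\<dots> \<le> (\<Sum>y\<in>?N. \<integral>w. edge_score w {a, y} * edge_mass n r a y w \<partial>BP)"
    by (rule member_le_sum[of b, OF _ _ finN]) (use e expectation_score_edge_mass_nonneg in auto)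
  also have "\<dots> = (\<integral>w. (\<Sum>y\<in>?N. edge_score w {a, y} * edge_mass n r a y w) \<partial>BP)"
    by (rule Bochner_Integration.integral_sum[symmetric]) (rule int)
  also have "\<dots> = (\<integral>w. (\<Sum>u\<in>?D. transport n r u a w) \<partial>BP)"
    by (simp only: sum_transport_in[OF a])
  also have "\<dots> = (\<Sum>u\<in>?D. F u a)"
    unfolding F_def by (rule Bochner_Integration.integral_sum) (use D a integrable_transport in auto)
  also have "\<dots> = (\<Sum>v\<in>?D. F a v)"
    by (rule mass_transport[OF trans unimod a, symmetric]) (rule inv)
  also have "\<dots> = (\<integral>w. (\<Sum>v\<in>?D. transport n r a v w) \<partial>BP)"
    unfolding F_def by (rule Bochner_Integration.integral_sum[symmetric]) (use D a integrable_transport in auto)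
  also have "\<dots> = 2 * (\<integral>w. vertex_mass n r (cluster E w a) * fluctuation (cluster E w a) w \<partial>BP)"
    by (simp add: sum_transport_out[OF a] mult.assoc)
  finally show ?thesis .
qed

end

section \<open>Two real inequalities behind the rate\<close>

lemma sum_inverse_three_halves_le:
  assumes "1 \<le> n"
  shows "(\<Sum>i\<in>{0<..M}. 1 / (real (max n i) * sqrt (real (max n i)))) \<le> 3 / sqrt (real n)"
proof -
  let ?g = "\<lambda>i. 1 / (real (max n i) * sqrt (real (max n i)))"
  have low: "(\<Sum>i\<in>{0<..M}. ?g i) = M / (real n * sqrt (real n))" if "M \<le> n" for M
  proof -
    have "(\<Sum>i\<in>{0<..M}. ?g i) = (\<Sum>i\<in>{0<..M}. 1 / (real n * sqrt (real n)))"
      using that by (intro sum.cong) auto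
    then show ?thesis by simp
  qed
  \<comment> \<open>The indices up to \<open>n\<close> contribute \<open>1 / sqrt n\<close>. Beyond
    \<open>n\<close>, the term at \<open>M + 1\<close> is at most
    \<open>2 / sqrt M - 2 / sqrt (M + 1)\<close>, and these differences telescope to less than
    \<open>2 / sqrt n\<close>.\<close>
  have high: "(\<Sum>i\<in>{0<..M}. ?g i) \<le> 3 / sqrt (real n) - 2 / sqrt (real M)" if "n \<le> M" for M
    using that
  proof (induction M rule: dec_induct)
    case base
    have "real n / (real n * sqrt (real n)) = 1 / sqrt (real n)" using assms by simp
    then show ?case using low[of n] by (simp add: diff_divide_distrib[symmetric])
  next
    case (step M)
    define u where "u = sqrt (real M)"
    define v where "v = sqrt (real (Suc M))"
    have u: "0 < u" "u \<le> v" using assms step by (auto simp: u_def v_def)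
    then have v: "0 < v" by linarith
    have sq: "(v - u) * (u + v) = 1"
      by (simp add: algebra_simps u_def v_def)
    have "u * (u + v) \<le> v * (v + v)" using u by (intro mult_mono) auto
    then have "u * (u + v) * (v - u) \<le> v * (v + v) * (v - u)" using u by (intro mult_right_mono) auto
    moreover have "u * (u + v) * (v - u) = u" using sq by (simp add: algebra_simps)
    ultimately have "u \<le> 2 * v * v * (v - u)" by (simp add: algebra_simps)
    then have "1 / (v * v * v) \<le> 2 / u - 2 / v"
      using u v by (simp add: field_simps)
    moreover have "?g (Suc M) = 1 / (v * v * v)"
      using step by (simp add: v_def max_def)
    moreover have "{0<..Suc M} = insert (Suc M) {0<..M}" by auto
    ultimately show ?case using step.IH by (simp add: u_def v_def)
  qed
  show ?thesis
  proof (cases "n \<le> M")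
    case True
    have "0 \<le> 2 / sqrt (real M)" by simp
    then show ?thesis using high[OF True] by linarith
  next
    case False
    have "real M / (real n * sqrt (real n)) \<le> real n / (real n * sqrt (real n))"
      using False by (intro divide_right_mono) auto
    also have "\<dots> = 1 / sqrt (real n)" using assms by simp
    also have "\<dots> \<le> 3 / sqrt (real n)" by (intro divide_right_mono) auto
    finally show ?thesis using low[of M] False by simp
  qed
qed

text \<open>This is the square of \<open>l * \<bar>h\<bar> - sqrt m\<close>, divided by
  \<open>2 * l * m * sqrt m\<close>. The parameter \<open>l\<close> is left free to balance the two
  terms later.\<close>

lemma abs_div_le_weighted_square:
  fixes h m l :: real
  assumes "0 < m" "0 < l"
  shows "\<bar>h\<bar> / m \<le> (l * (h\<^sup>2 / (m * sqrt m)) + 1 / (l * sqrt m)) / 2"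
proof -
  define s where "s = sqrt m"
  have s: "0 < s" "m = s * s" using assms by (auto simp: s_def)
  have "0 \<le> (l * \<bar>h\<bar> - s)\<^sup>2 / (2 * l * (s * s * s))" using s assms by simp
  also have "\<dots> = (l * (h\<^sup>2 / (s * s * s)) + 1 / (l * s)) / 2 - \<bar>h\<bar> / (s * s)"
    using s assms by (simp add: power2_diff field_simps) (simp add: power2_eq_square algebra_simps)
  finally have "\<bar>h\<bar> / (s * s) \<le> (l * (h\<^sup>2 / (s * s * s)) + 1 / (l * s)) / 2" by simp
  then show ?thesis by (simp only: s_def[symmetric] s(2)[symmetric])
qed

section \<open>From the fluctuation bound to the probability of the event\<close>

context edge_percolation
begin

lemma card_touching_le:
  assumes "regular_of_degree V E d" "C \<subseteq> V" "finite C"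
  shows "card (touching_edges E C) \<le> d * card C"
proof -
  have "card (touching_edges E C) \<le> (\<Sum>v\<in>C. card (incident_edges E v))"
    unfolding touching_edges_eq by (rule card_UN_le[OF assms(3)])
  also have "\<dots> = d * card C"
    using assms by (simp add: regular_of_degree_def subset_iff)
  finally show ?thesis .
qed

text \<open>The product of \<open>min\<close> and \<open>max\<close> of two numbers is their
  product, and regularity gives at most \<open>d * card C\<close> touching edges.\<close>

lemma vertex_mass_le:
  assumes reg: "regular_of_degree V E d" and C: "small_set r C" and n: "1 \<le> n"
    and T: "touching_edges E C \<noteq> {}"
  shows "vertex_mass n r C \<le> d / max n (card (touching_edges E C))"
proof -
  let ?T = "card (touching_edges E C)"
  obtain v where v: "v \<in> C" using T by (auto simp: touching_edges_def)
  have T0: "0 < ?T" using T small_set_touching(3)[OF C v] by (simp add: card_gt_0_iff)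
  have c0: "0 < card C" using v small_set_finite[OF C] card_gt_0_iff by blast
  have "?T \<le> d * card C"
    using card_touching_le[OF reg] C small_set_finite[OF C] by (auto simp: small_set_def)
  then have Tle: "real ?T \<le> d * card C" by (metis of_nat_le_iff of_nat_mult)
  have mm: "real (min ?T n) * real (max n ?T) = real n * real ?T"
    by (simp add: min_def max_def mult.commute)
  have "real (min ?T n) * real (max n ?T) \<le> d * (n * card C)"
    unfolding mm using Tle mult_left_mono[OF Tle, of "real n"] by (simp add: algebra_simps)
  then have "real (min ?T n) / (n * card C) \<le> d / max n ?T"
    using n c0 by (simp add: field_simps)
  then show ?thesis using C by (simp add: vertex_mass_def cluster_mass_def)
qed

lemma small_set_mono: "small_set r C \<Longrightarrow> r \<le> s \<Longrightarrow> small_set s C"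
  unfolding small_set_def using graph_ball_mono[of r s E] by (meson order_trans)

lemma finite_imp_small_set:
  assumes "C \<subseteq> V" "finite C"
  obtains r where "small_set r C"
proof -
  have "\<exists>r. \<forall>u\<in>C. u \<in> graph_ball E r x" if x: "x \<in> C" for x
  proof -
    have "\<forall>u\<in>C. \<exists>r. u \<in> graph_ball E r x" using x assms ball_exhausts by blast
    then obtain k where k: "\<forall>u\<in>C. u \<in> graph_ball E (k u) x" by metis
    have "u \<in> graph_ball E (Max (k ` C)) x" if u: "u \<in> C" for u
    proof -
      have "k u \<le> Max (k ` C)" using u assms(2) by simp
      from graph_ball_mono[OF this, of E x] show ?thesis using k u by blast
    qed
    then show ?thesis by blast
  qed
  then obtain k where k: "\<And>x u. x \<in> C \<Longrightarrow> u \<in> C \<Longrightarrow> u \<in> graph_ball E (k x) x" by metis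
  have "u \<in> graph_ball E (Max (k ` C)) x" if x: "x \<in> C" and u: "u \<in> C" for x u
  proof -
    have "k x \<le> Max (k ` C)" using x assms(2) by simp
    from graph_ball_mono[OF this, of E x] show ?thesis using k[OF x u] by blast
  qed
  then have "small_set (Max (k ` C)) C" using assms by (auto simp: small_set_def)
  then show ?thesis by (rule that)
qed

lemma expectation_vertex_mass_fluctuation_le:
  assumes reg: "regular_of_degree V E d" and a: "a \<in> V" and d: "incident_edges E a \<noteq> {}"
    and n: "1 \<le> n" and l: "0 < l"
  shows "(\<integral>w. vertex_mass n r (cluster E w a) * fluctuation (cluster E w a) w \<partial>BP)
    \<le> d / 2 * (l * (p * (1 - p) * (3 / sqrt n)) + 1 / (l * sqrt n))"
proof -
  \<comment> \<open>This is the weight that \<open>abs_div_le_weighted_square\<close> puts on the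
    square when \<open>m = max n k\<close>. Taking the maximum with \<open>n\<close> keeps it finite
    at 0 and makes its sum of order \<open>1 / sqrt n\<close>.\<close>
  define g where "g k = 1 / (real (max n k) * sqrt (real (max n k)))" for k
  let ?K = "\<lambda>w. cluster E w a"
  have g0: "0 \<le> g k" for k by (simp add: g_def)
  have gm: "g k \<le> g j" if "j \<le> k" for j k
    unfolding g_def using n that by (intro divide_left_mono mult_mono mult_pos_pos) auto
  have int: "integrable BP (\<lambda>w. energy g r (?K w) w)"
    by (rule BP.integrable_const_bound[OF _ measurable_energy[OF a]])
       (use abs_energy_le[where g=g, OF g0 gm order.refl] in \<open>auto intro!: AE_I2\<close>)
  have pw: "vertex_mass n r (?K w) * fluctuation (?K w) w
      \<le> d / 2 * (l * energy g r (?K w) w + 1 / (l * sqrt n))" for w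
  proof (cases "small_set r (?K w)")
    case True
    let ?m = "max n (card (touching_edges E (?K w)))" and ?h = "fluctuation (?K w) w"
    have m: "0 < real ?m" using n by simp
    obtain f where "f \<in> E" "a \<in> f" using d by (auto simp: incident_edges_def)
    then have "f \<in> touching_edges E (?K w)"
      using cluster_self[of a w] by (auto simp: touching_edges_def simp del: cluster_self)
    then have "touching_edges E (?K w) \<noteq> {}" by auto
    then have vm: "vertex_mass n r (?K w) \<le> d / ?m" by (rule vertex_mass_le[OF reg True n])
    have v0: "0 \<le> vertex_mass n r (?K w)" by (simp add: vertex_mass_def cluster_mass_bounds)
    have "vertex_mass n r (?K w) * ?h \<le> vertex_mass n r (?K w) * \<bar>?h\<bar>"
      using v0 by (intro mult_left_mono) auto
    also have "\<dots> \<le> d / ?m * \<bar>?h\<bar>" by (intro mult_right_mono vm) auto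
    also have "\<dots> = d * (\<bar>?h\<bar> / ?m)" by simp
    also have "\<dots> \<le> d * ((l * (?h\<^sup>2 / (?m * sqrt ?m)) + 1 / (l * sqrt ?m)) / 2)"
      by (intro mult_left_mono abs_div_le_weighted_square m l) auto
    also have "\<dots> \<le> d * ((l * (?h\<^sup>2 / (?m * sqrt ?m)) + 1 / (l * sqrt n)) / 2)"
      using n l by (intro mult_left_mono divide_right_mono add_mono divide_left_mono mult_pos_pos) auto
    also have "\<dots> = d / 2 * (l * energy g r (?K w) w + 1 / (l * sqrt n))"
      using True by (simp add: energy_def g_def)
    finally show ?thesis .
  next
    case False
    then show ?thesis using l by (simp add: vertex_mass_def cluster_mass_def energy_def)
  qed
  have dom: "integrable BP (\<lambda>w. d / 2 * (l * energy g r (?K w) w + 1 / (l * sqrt n)))"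
    using int by simp
  show ?thesis
  proof (cases "integrable BP (\<lambda>w. vertex_mass n r (?K w) * fluctuation (?K w) w)")
    case True
    have "(\<integral>w. vertex_mass n r (?K w) * fluctuation (?K w) w \<partial>BP)
        \<le> (\<integral>w. d / 2 * (l * energy g r (?K w) w + 1 / (l * sqrt n)) \<partial>BP)"
      by (rule integral_mono[OF True dom pw])
    also have "\<dots> = d / 2 * (l * (\<integral>w. energy g r (?K w) w \<partial>BP) + 1 / (l * sqrt n))"
      using int by (simp add: BP.prob_space)
    also have "\<dots> \<le> d / 2 * (l * (p * (1 - p) * (3 / sqrt n)) + 1 / (l * sqrt n))"
      using l sum_inverse_three_halves_le[OF n]
      by (intro mult_left_mono add_right_mono cluster_energy_bound a g0 gm) (auto simp: g_def)
    finally show ?thesis .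
  next
    case False
    \<comment> \<open>A non-integrable function has Bochner integral 0 by convention, and the
      right-hand side is nonnegative.\<close>
    then show ?thesis using l p01 by (simp add: not_integrable_integral_eq)
  qed
qed

lemma prob_pivotal_event_bound:
  assumes trans: "transitive_graph V E" and unimod: "unimodular_graph V E"
    and reg: "regular_of_degree V E d" and e: "{a, b} \<in> E" and n: "1 \<le> n" and p: "0 < p"
  shows "measure BP (pivotal_event n r a b) \<le> 4 * real d * sqrt ((1 - p) / (p * n))"
proof (cases "p = 1")
  case True
  \<comment> \<open>The factor \<open>1 - p\<close> makes the expected product vanish, so the
    probability is 0. This case is separate because \<open>q\<close> would be 0.\<close>
  then show ?thesis
    using prob_pivotal_event_le[OF e, of n r] expectation_score_edge_mass[OF e, of n r] by simp
next
  case False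
  \<comment> \<open>The choice \<open>l = 1 / q\<close> turns the two terms into
    \<open>3 * q / sqrt n\<close> and \<open>q / sqrt n\<close>. Their sum, times
    \<open>d / 2\<close> and the factor 2 from the endpoints, yields the constant 4.\<close>
  define q where "q = sqrt (p * (1 - p))"
  have a: "a \<in> V" using edge_subset[OF e] by simp
  have q: "0 < q" "p * (1 - p) = q * q" using p p01 False by (auto simp: q_def)
  have d: "incident_edges E a \<noteq> {}" using e by (auto simp: incident_edges_def)
  have "p * measure BP (pivotal_event n r a b)
      \<le> 2 * (d / 2 * (1 / q * (p * (1 - p) * (3 / sqrt n)) + 1 / (1 / q * sqrt n)))"
    using prob_pivotal_le_fluctuation[OF trans unimod e, of n r]
      expectation_vertex_mass_fluctuation_le[OF reg a d n, of "1 / q" r] q(1) by simp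
  also have "\<dots> = 4 * real d * (q / sqrt n)"
    unfolding q(2) using q(1) n by (simp add: field_simps)
  finally have "measure BP (pivotal_event n r a b) \<le> 4 * real d * (q / sqrt n) / p"
    unfolding pos_le_divide_eq[OF p] by (simp only: mult.commute)
  also have "\<dots> = 4 * real d * sqrt ((1 - p) / (p * n))"
  proof -
    have "q / p = (sqrt p * sqrt (1 - p)) / (sqrt p * sqrt p)"
      using p by (simp add: q_def real_sqrt_mult)
    also have "\<dots> = sqrt (1 - p) / sqrt p"
      using p by (intro mult_divide_mult_cancel_left) simp
    finally have "q / p = sqrt (1 - p) / sqrt p" .
    then have "4 * real d * (q / sqrt n) / p = 4 * real d * ((sqrt (1 - p) / sqrt p) / sqrt n)"
      by (metis divide_divide_eq_left' mult.commute times_divide_eq_right)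
    then show ?thesis by (simp add: real_sqrt_divide real_sqrt_mult)
  qed
  finally show ?thesis .
qed

text \<open>The finite cluster is small for all large radii, and closing an already closed edge
  changes nothing, so \<open>edge_mass_gap\<close> applies at each such radius.\<close>

lemma two_cluster_event_eventually_pivotal:
  assumes e: "{a, b} \<in> E" and n: "1 \<le> n" and w: "w \<in> two_cluster_event E p {a, b} n"
  obtains r where "\<And>s. r \<le> s \<Longrightarrow> w \<in> pivotal_event n s a b"
proof -
  let ?A = "cluster E w a" and ?B = "cluster E w b"
  from w obtain x y where xy: "{a, b} = {x, y}" "cluster E w x \<noteq> cluster E w y"
      "touches_at_least E n (cluster E w x)" "touches_at_least E n (cluster E w y)"
      "finite (cluster E w x) \<or> finite (cluster E w y)"
    and sp: "w \<in> space BP" "\<not> w {a, b}"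
    unfolding two_cluster_event_def by blast
  have ab: "?A \<noteq> ?B" "touches_at_least E n ?A" "touches_at_least E n ?B" "finite ?A \<or> finite ?B"
    using xy by (auto simp: doubleton_eq_iff)
  have V: "a \<in> V" "b \<in> V" using edge_subset[OF e] by auto
  obtain r where r: "small_set r ?A \<or> small_set r ?B"
    using ab(4) finite_imp_small_set[OF cluster_subset[OF V(1)], of w]
      finite_imp_small_set[OF cluster_subset[OF V(2)], of w] by blast
  have "w({a, b} := False) = w" using sp by (auto simp: fun_eq_iff)
  then have "w \<in> pivotal_event n s a b" if "r \<le> s" for s
    using edge_mass_gap[OF e _ ab(1) n ab(2,3), of s] r small_set_mono[OF _ that] sp
    by (auto simp: pivotal_event_def)
  then show ?thesis by (rule that)
qed

text \<open>Pivotal events need not increase with \<open>r\<close>: once both clusters and their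
  union are small, the gap may shrink. Their tail intersections do increase, and each is contained
  in a single pivotal event.\<close>

lemma prob_two_cluster_event_le:
  assumes e: "{a, b} \<in> E" and n: "1 \<le> n"
    and bound: "\<And>r. measure BP (pivotal_event n r a b) \<le> K"
  shows "measure BP (two_cluster_event E p {a, b} n) \<le> K"
proof -
  define U where "U r = (\<Inter>s\<in>{r..}. pivotal_event n s a b)" for r
  have U: "U r \<in> sets BP" for r
    unfolding U_def using sets_pivotal_event[OF e] by (intro sets.countable_INT) auto
  have "incseq U" by (auto simp: incseq_def U_def)
  then have "(\<lambda>r. measure BP (U r)) \<longlonglongrightarrow> measure BP (\<Union>r. U r)"
    using U by (intro BP.finite_Lim_measure_incseq) auto
  moreover have "measure BP (U r) \<le> K" for r
  proof -
    have "measure BP (U r) \<le> measure BP (pivotal_event n r a b)"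
      by (rule BP.finite_measure_mono) (auto simp: U_def sets_pivotal_event[OF e])
    then show ?thesis using bound[of r] by simp
  qed
  ultimately have "measure BP (\<Union>r. U r) \<le> K" by (intro LIMSEQ_le_const2) auto
  moreover have "two_cluster_event E p {a, b} n \<subseteq> (\<Union>r. U r)"
  proof
    fix w assume "w \<in> two_cluster_event E p {a, b} n"
    from two_cluster_event_eventually_pivotal[OF e n this]
    obtain r where "\<And>s. r \<le> s \<Longrightarrow> w \<in> pivotal_event n s a b" by blast
    then show "w \<in> (\<Union>r. U r)" by (auto simp: U_def)
  qed
  \<comment> \<open>Monotonicity of the measure asks for measurability of the larger set
    only.\<close>
  then have "measure BP (two_cluster_event E p {a, b} n) \<le> measure BP (\<Union>r. U r)"
    using U by (intro BP.finite_measure_mono) auto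
  ultimately show ?thesis by simp
qed

end

theorem corollary1p7:
  fixes V :: "'v set" and E :: "'v set set" and d n :: nat and p :: real and e :: "'v set"
  assumes "simple_graph V E"
    and "connected_graph V E"
    and "locally_finite_graph V E"
    and "transitive_graph V E"
    and "unimodular_graph V E"
    and "regular_of_degree V E d"
    and "e \<in> E"
    and "0 < p" and "p \<le> 1"
    and "n \<ge> 1"
  shows "measure (bernoulli_percolation E p) (two_cluster_event E p e n)
           \<le> 66 * real d * sqrt ((1 - p) / (p * real n))"
proof -
  interpret edge_percolation V E p
    using assms by (intro edge_percolation.intro connected_lf_graph.intro
      connected_lf_graph_axioms.intro edge_percolation_axioms.intro) auto
  obtain a b where e: "e = {a, b}" using edge_doubleton[OF assms(7)] by blast
  have "measure BP (two_cluster_event E p e n) \<le> 4 * real d * sqrt ((1 - p) / (p * n))"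
    unfolding e using assms(7)[unfolded e]
    by (intro prob_two_cluster_event_le prob_pivotal_event_bound assms)
  also have "\<dots> \<le> 66 * real d * sqrt ((1 - p) / (p * real n))"
    using assms(8,9) by (intro mult_right_mono) auto
  finally show ?thesis .
qed

end
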